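(* Let $\mathscr{D}\subset\mathbb{R}^D$ be open, let $\mathscr{U}\subset\mathscr{D}$ be a nonempty bounded open set, let $A_1,\dots,A_D$ be constant real $m\times n$ matrices, and for every $y\in\mathscr{D}$ let $K_y\subset\mathbb{R}^n$ be a compact set. Consider for $z\colon\mathscr{D}\to\mathbb{R}^n$ the linear system $$\text{(L)}\quad \sum_{i=1}^D A_i\,\partial_i z=0\ \text{ in }\mathscr{D}$$ and the nonlinear constraint $$\text{(N)}\quad z(y)\in K_y .$$ Suppose that there exists a wave cone $\Lambda$ for (L) which is dense in $\mathbb{R}^n$, and that the map $\mathscr{U}\ni y\mapsto K_y$ is continuous and bounded with respect to the Hausdorff metric. Suppose that $z_0$ is a subsolution of (L), (N). Then there exist infinitely many weak solutions $z\in L^2(\mathscr{D};\mathbb{R}^n)$ of (L) which agree with $z_0$ a.e. on $\mathscr{D}\setminus\mathscr{U}$ and satisfy $z(y)\in K_y$ for a.e. $y\in\mathscr{D}$.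
   Context: Weak solutions are solutions in the sense of distributions. Elements of $L^2$ are identified when equal a.e. For $y\in\mathscr{D}$ set $U_y:=\operatorname{int}\operatorname{conv}K_y$, the interior of the convex hull of $K_y$. Subsolution: $z\in L^2(\mathscr{D};\mathbb{R}^n)$ is a subsolution of (L), (N) if $z$ is a weak solution of (L) in $\mathscr{D}$, $z$ is continuous on $\mathscr{U}$, $z(y)\in K_y$ for a.e. $y\in\mathscr{D}\setminus\mathscr{U}$, and $z(y)\in U_y$ for every $y\in\mathscr{U}$. Wave cone: a set $\Lambda\subset\mathbb{R}^n$ is called a wave cone for (L) if there exists a constant $C>0$ such that for every $\bar z\in\Lambda$ there exists a sequence $w_k\in C_0^\infty(B_1(0);\mathbb{R}^n)$, $k\in\mathbb{N}$ (smooth, compactly supported in the unit ball $B_1(0)\subset\mathbb{R}^D$), each solving $\sum_{i=1}^D A_i\partial_i w_k=0$ in $\mathbb{R}^D$, such that: (i) $\operatorname{dist}(w_k(x),[-\bar z,\bar z])\to0$ uniformly for $x\in B_1(0)$ as $k\to\infty$; (ii) $w_k\rightharpoonup0$ weakly in $L^2$ as $k\to\infty$; (iii) $\int|w_k|^2\,dy>C|\bar z|^2$ for all $k\in\mathbb{N}$. Here $[x,y]:=\operatorname{conv}\{x,y\}$ is the segment with endpoints $x,y$. The Hausdorff metric $d_{\mathcal{H}}$ is considered on the set of all (nonempty) compact subsets of $\mathbb{R}^n$; a map into this space is bounded if its image is a bounded set for $d_{\mathcal{H}}$. *)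

theory Defs
  imports "HOL-Analysis.Analysis"
begin

definition partial_deriv :: "'d::finite \<Rightarrow> (real^'d \<Rightarrow> 'b::real_normed_vector) \<Rightarrow> real^'d \<Rightarrow> 'b"
  where "partial_deriv i f x = frechet_derivative f (at x) (axis i 1)"

primrec Ck :: "nat \<Rightarrow> (real^'d::finite \<Rightarrow> 'b::real_normed_vector) \<Rightarrow> bool" where
  "Ck 0 f \<longleftrightarrow> continuous_on UNIV f"
| "Ck (Suc k) f \<longleftrightarrow> (\<forall>x. f differentiable (at x)) \<and> (\<forall>i. Ck k (partial_deriv i f))"

text \<open>Functions in \<open>C\<^sub>c\<^sup>\<infinity>(\<Omega>)\<close> are represented by their extension by zero to the whole space.\<close>

definition test_functions ::
    "(real^'d::finite) set \<Rightarrow> (real^'d \<Rightarrow> 'b::real_normed_vector) set"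
  where "test_functions \<Omega> =
    {f. (\<forall>k. Ck k f) \<and> compact (closure {x. f x \<noteq> 0}) \<and> closure {x. f x \<noteq> 0} \<subseteq> \<Omega>}"

definition L2 :: "(real^'d::finite) set \<Rightarrow> (real^'d \<Rightarrow> real^'n::finite) set"
  where "L2 \<Omega> = {f. f \<in> borel_measurable (lebesgue_on \<Omega>) \<and>
                    integrable (lebesgue_on \<Omega>) (\<lambda>x. (norm (f x))\<^sup>2)}"

text \<open>The space usually called \<open>L\<^sup>2(\<Omega>)\<close> is the quotient \<open>L2 \<Omega> // L2_eq \<Omega>\<close>.\<close>

definition L2_eq ::
    "(real^'d::finite) set \<Rightarrow> ((real^'d \<Rightarrow> real^'n::finite) \<times> (real^'d \<Rightarrow> real^'n)) set"
  where "L2_eq \<Omega> = {(f, g). f \<in> L2 \<Omega> \<and> g \<in> L2 \<Omega> \<and> (AE x in lebesgue_on \<Omega>. f x = g x)}"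

lemma equiv_L2_eq: "equiv (L2 \<Omega>) (L2_eq \<Omega>)"
proof (rule equivI)
  show "L2_eq \<Omega> \<subseteq> L2 \<Omega> \<times> L2 \<Omega>" by (auto simp: L2_eq_def)
  show "refl_on (L2 \<Omega>) (L2_eq \<Omega>)" by (auto simp: refl_on_def L2_eq_def)
  show "sym (L2_eq \<Omega>)"
    by (auto simp: sym_def L2_eq_def elim: AE_mp)
  show "trans (L2_eq \<Omega>)"
  proof (rule transI)
    fix f g h assume fg: "(f, g) \<in> L2_eq \<Omega>" and gh: "(g, h) \<in> L2_eq \<Omega>"
    then have "AE x in lebesgue_on \<Omega>. f x = g x" "AE x in lebesgue_on \<Omega>. g x = h x"
      by (auto simp: L2_eq_def)
    then have "AE x in lebesgue_on \<Omega>. f x = h x" by eventually_elim simp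
    with fg gh show "(f, h) \<in> L2_eq \<Omega>" by (auto simp: L2_eq_def)
  qed
qed

definition L2_weakly_tendsto ::
    "(real^'d::finite) set \<Rightarrow> (nat \<Rightarrow> real^'d \<Rightarrow> real^'n::finite) \<Rightarrow> (real^'d \<Rightarrow> real^'n) \<Rightarrow> bool"
  where "L2_weakly_tendsto \<Omega> w v \<longleftrightarrow>
    (\<forall>g \<in> L2 \<Omega>. (\<lambda>k. \<integral>x. w k x \<bullet> g x \<partial>lebesgue_on \<Omega>)
                  \<longlonglongrightarrow> (\<integral>x. v x \<bullet> g x \<partial>lebesgue_on \<Omega>))"

text \<open>
  Distributional solutions of \<open>\<Sum>i. A\<^sub>i \<partial>\<^sub>i z = 0\<close>, with one scalar test function for all
  rows of the system.  Membership in \<open>L2\<close> makes the integrand integrable for every test function.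
\<close>

definition L2_weak_solution ::
    "('d::finite \<Rightarrow> real^'n::finite^'m::finite) \<Rightarrow> (real^'d) set \<Rightarrow> (real^'d \<Rightarrow> real^'n) \<Rightarrow> bool"
  where "L2_weak_solution A \<Omega> z \<longleftrightarrow> z \<in> L2 \<Omega> \<and>
    (\<forall>\<phi> \<in> test_functions \<Omega>.
       (\<integral>y. (\<Sum>i\<in>UNIV. partial_deriv i \<phi> y *\<^sub>R (A i *v z y)) \<partial>lebesgue_on \<Omega>) = 0)"

definition wave_cone ::
    "('d::finite \<Rightarrow> real^'n::finite^'m::finite) \<Rightarrow> (real^'n) set \<Rightarrow> bool"
  where "wave_cone A \<Lambda> \<longleftrightarrow>
    (\<exists>C>0. \<forall>zb\<in>\<Lambda>. \<exists>w :: nat \<Rightarrow> real^'d \<Rightarrow> real^'n.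
       (\<forall>k. w k \<in> test_functions (ball 0 1) \<and>
            (\<forall>x. (\<Sum>i\<in>UNIV. A i *v partial_deriv i (w k) x) = 0)) \<and>
       uniform_limit (ball 0 1) (\<lambda>k x. infdist (w k x) (closed_segment (- zb) zb))
         (\<lambda>_. 0) sequentially \<and>
       L2_weakly_tendsto (ball 0 1) w (\<lambda>_. 0) \<and>
       (\<forall>k. (\<integral>y. (norm (w k y))\<^sup>2 \<partial>lebesgue) > C * (norm zb)\<^sup>2))"

definition subsolution ::
    "('d::finite \<Rightarrow> real^'n::finite^'m::finite) \<Rightarrow> (real^'d) set \<Rightarrow> (real^'d) set \<Rightarrow>
     (real^'d \<Rightarrow> (real^'n) set) \<Rightarrow> (real^'d \<Rightarrow> real^'n) \<Rightarrow> bool"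
  where "subsolution A \<D> \<U> K z \<longleftrightarrow>
    L2_weak_solution A \<D> z \<and>
    continuous_on \<U> z \<and>
    (AE y in lebesgue_on (\<D> - \<U>). z y \<in> K y) \<and>
    (\<forall>y\<in>\<U>. z y \<in> interior (convex hull (K y)))"

definition nonempty_compacts :: "'a::metric_space set set"
  where "nonempty_compacts = {S. compact S \<and> S \<noteq> {}}"

text \<open>The value outside \<^const>\<open>nonempty_compacts\<close> is a dummy: the locale
  \<^locale>\<open>Metric_space\<close> requires nonnegativity and symmetry off the carrier as well.\<close>

definition hausdorff_dist :: "'a::metric_space set \<Rightarrow> 'a set \<Rightarrow> real"
  where "hausdorff_dist S T =
    (if S \<in> nonempty_compacts \<and> T \<in> nonempty_compacts
     then max (SUP x\<in>S. infdist x T) (SUP y\<in>T. infdist y S) else 0)"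

lemma infdist_le_SUP:
  assumes "compact S" "x \<in> S"
  shows "infdist x T \<le> (SUP x\<in>S. infdist x T)"
proof (rule cSUP_upper[OF assms(2)])
  have "compact ((\<lambda>x. infdist x T) ` S)"
    by (intro compact_continuous_image continuous_intros assms)
  then show "bdd_above ((\<lambda>x. infdist x T) ` S)"
    by (intro bounded_imp_bdd_above compact_imp_bounded)
qed

lemma infdist_triangle_SUP:
  assumes "S \<in> nonempty_compacts" "T \<in> nonempty_compacts" "R \<in> nonempty_compacts"
  shows "(SUP x\<in>S. infdist x R) \<le> (SUP x\<in>S. infdist x T) + (SUP x\<in>T. infdist x R)"
proof (rule cSUP_least)
  show "S \<noteq> {}" using assms by (simp add: nonempty_compacts_def)
  fix x assume x: "x \<in> S"
  have "continuous_on T (dist x)" by (intro continuous_intros)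
  then obtain t where "t \<in> T" and min: "\<And>u. u \<in> T \<Longrightarrow> dist x t \<le> dist x u"
    using continuous_attains_inf[of T "dist x"] assms(2)
    unfolding nonempty_compacts_def by blast
  then have t: "t \<in> T" "dist x t \<le> infdist x T"
    by (auto simp: infdist_def intro!: cINF_greatest)
  have "infdist x R \<le> infdist t R + dist x t" by (rule infdist_triangle)
  also have "infdist t R \<le> (SUP x\<in>T. infdist x R)"
    using assms t by (intro infdist_le_SUP) (auto simp: nonempty_compacts_def)
  also have "dist x t \<le> (SUP x\<in>S. infdist x T)"
    using infdist_le_SUP[of S x T] assms x t by (auto simp: nonempty_compacts_def)
  finally show "infdist x R \<le> (SUP x\<in>S. infdist x T) + (SUP x\<in>T. infdist x R)" by simp
qed

lemma SUP_infdist_nonneg: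
  assumes "S \<in> nonempty_compacts"
  shows "0 \<le> (SUP x\<in>S. infdist x T)"
proof -
  obtain x where "x \<in> S" using assms by (auto simp: nonempty_compacts_def)
  with assms have "infdist x T \<le> (SUP x\<in>S. infdist x T)"
    by (intro infdist_le_SUP) (auto simp: nonempty_compacts_def)
  then show ?thesis using infdist_nonneg order_trans by blast
qed

lemma SUP_infdist_zero:
  assumes "S \<in> nonempty_compacts" "T \<in> nonempty_compacts" "(SUP x\<in>S. infdist x T) \<le> 0"
  shows "S \<subseteq> T"
proof
  fix x assume x: "x \<in> S"
  then have "infdist x T \<le> 0"
    using infdist_le_SUP[of S x T] assms by (auto simp: nonempty_compacts_def)
  then have "infdist x T = 0" using infdist_nonneg[of x T] by linarith
  then show "x \<in> T"
    using in_closed_iff_infdist_zero[of T x] assms compact_imp_closed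
    by (auto simp: nonempty_compacts_def)
qed

interpretation hausdorff: Metric_space nonempty_compacts hausdorff_dist
proof
  fix S T R :: "'a set"
  show "0 \<le> hausdorff_dist S T"
    by (auto simp: hausdorff_dist_def le_max_iff_disj SUP_infdist_nonneg)
  show "hausdorff_dist S T = hausdorff_dist T S"
    by (auto simp: hausdorff_dist_def max.commute)
  assume S: "S \<in> nonempty_compacts" and T: "T \<in> nonempty_compacts"
  show "hausdorff_dist S T = 0 \<longleftrightarrow> S = T"
  proof
    assume "hausdorff_dist S T = 0"
    then have "(SUP x\<in>S. infdist x T) \<le> 0" "(SUP x\<in>T. infdist x S) \<le> 0"
      using S T by (auto simp: hausdorff_dist_def max_def split: if_splits)
    then show "S = T" using SUP_infdist_zero S T by blast
  next
    assume "S = T"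
    moreover have "(SUP x\<in>S. infdist x S) = 0"
      using S by (auto simp: nonempty_compacts_def)
    ultimately show "hausdorff_dist S T = 0" by (auto simp: hausdorff_dist_def)
  qed
  assume R: "R \<in> nonempty_compacts"
  show "hausdorff_dist S R \<le> hausdorff_dist S T + hausdorff_dist T R"
    using infdist_triangle_SUP[OF S T R] infdist_triangle_SUP[OF R T S] S T R
    by (auto simp: hausdorff_dist_def)
qed

end

(* Call z strict if it is continuous on U with z(y) in the interior of conv K_y for all y in U. By
   Caratheodory, a point z of int conv K_y is the midpoint of a segment in int conv K_y of length at
   least c * dist(z, K_y), whose direction can be taken in the dense wave cone. Placing rescaled
   localized waves on a Vitali family of small disjoint balls therefore perturbs any strict z to
   another strict z + w, where the squared L2 norm of w is at least beta times the squared L2 norm of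
   dist(z, K) and w is almost orthogonal to finitely many prescribed functions. Iterating with
   increments almost orthogonal to all earlier iterates gives a sequence converging strongly in L2,
   and the limit takes values in K almost everywhere.

   Some z_0 + t w with w nonzero is strict for all t in [0,1]. The solution started at z_0 + t w can
   be kept weakly close to z_0 + t w when tested against w, so the pairings of the solutions with w
   are dense in an interval. This works even if z_0 is already a solution, which may happen because
   K_y may meet int conv K_y. *)

theory Submission
  imports Defs
begin

section \<open>Convex hulls and the Hausdorff distance\<close>


text \<open>The constraint does not survive weak limits, and the available waves tend to zero only
  weakly. The proof therefore hinges on bounding the energy of an increment from below by the
  defect, with a constant that is the same for all strict maps. Strong convergence makes the
  increments tend to zero in \<open>L2\<close>, and this bound then forces the defect to zero with
  them. The constant can be uniform because the wave cone bounds the ratio of energy to squared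
  amplitude by one number, rescaling multiplies the energy of a wave and the volume of its ball by
  the same power of the radius, and the geometric loss depends on the dimension alone. Radii and
  tolerances, in contrast, may degenerate from one map to the next: near a point of positive defect
  one direction works on some small ball, because \<open>K\<close> is continuous, and finitely many
  such balls already see half of the total defect. Each increment, extended by zero, solves the
  equation on the whole space. So no terms arise on the boundary of \<open>\<U>\<close>, and the
  equation is carried to the limit by the difference to z_0.\<close>

lemma hausdorff_dist_SUP_le:
  assumes "S \<in> nonempty_compacts" "T \<in> nonempty_compacts"
  shows "(SUP x\<in>S. infdist x T) \<le> hausdorff_dist S T"
  using assms by (simp add: hausdorff_dist_def)

lemma infdist_le_hausdorff_dist:
  assumes S: "S \<in> nonempty_compacts" and T: "T \<in> nonempty_compacts" and "x \<in> S"
  shows "infdist x T \<le> hausdorff_dist S T"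
  using infdist_le_SUP[of S x T] hausdorff_dist_SUP_le[OF S T] assms
  by (auto simp: nonempty_compacts_def)

text \<open>This is the triangle inequality for suprema of distances with the singleton
  \<open>{a}\<close> as first set, where each supremum over \<open>{a}\<close> is a single
  distance.\<close>

lemma infdist_hausdorff_triangle:
  assumes S: "S \<in> nonempty_compacts" and T: "T \<in> nonempty_compacts"
  shows "infdist a T \<le> infdist a S + hausdorff_dist S T"
proof -
  have "{a} \<in> nonempty_compacts" by (simp add: nonempty_compacts_def)
  from infdist_triangle_SUP[OF this S T] hausdorff_dist_SUP_le[OF S T]
  show ?thesis by simp
qed

lemma infdist_attained_close:
  fixes S T :: "'a::heine_borel set"
  assumes "S \<in> nonempty_compacts" "T \<in> nonempty_compacts" "x \<in> S"
  obtains t where "t \<in> T" "dist x t \<le> hausdorff_dist S T"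
proof -
  have T: "closed T" "T \<noteq> {}" using assms by (auto simp: nonempty_compacts_def intro: compact_imp_closed)
  then obtain t where "t \<in> T" "infdist x T = dist x t" by (rule infdist_attains_inf)
  with infdist_le_hausdorff_dist[OF assms] that show ?thesis by simp
qed

text \<open>A point missing from \<open>convex hull T\<close> can be separated from it and pushed by
  \<open>hausdorff_dist S T\<close> along the normal, which takes it out of \<open>convex hull S\<close>.\<close>

lemma interior_convex_hull_close:
  fixes S T :: "'a::euclidean_space set"
  assumes S: "S \<in> nonempty_compacts" and T: "T \<in> nonempty_compacts"
    and sub: "cball p \<rho> \<subseteq> convex hull S" and less: "hausdorff_dist S T < \<rho>"
  shows "p \<in> interior (convex hull T)"
proof -
  let ?\<eta> = "hausdorff_dist S T"
  have comp: "compact (convex hull T)"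
    using T by (intro compact_convex_hull) (simp add: nonempty_compacts_def)
  have "ball p (\<rho> - ?\<eta>) \<subseteq> convex hull T"
  proof
    fix q assume q: "q \<in> ball p (\<rho> - ?\<eta>)"
    show "q \<in> convex hull T"
    proof (rule ccontr)
      assume "q \<notin> convex hull T"
      then obtain a b where ab: "a \<bullet> q < b" "\<And>x. x \<in> convex hull T \<Longrightarrow> a \<bullet> x > b"
        using separating_hyperplane_closed_point[OF convex_convex_hull compact_imp_closed[OF comp]]
        by metis
      have "a \<noteq> 0"
      proof
        assume "a = 0"
        moreover obtain t where "t \<in> T" using T by (auto simp: nonempty_compacts_def)
        ultimately show False using ab(1) ab(2)[of t] hull_inc[of t T convex] by simp
      qed
      define q' where "q' = q - (?\<eta> / norm a) *\<^sub>R a"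
      have "dist q q' = ?\<eta>" using \<open>a \<noteq> 0\<close> hausdorff.nonneg[of S T] by (simp add: q'_def dist_norm)
      then have "q' \<in> cball p \<rho>" using q dist_triangle[of p q' q] by simp
      then have "q' \<in> convex hull S" using sub by blast
      moreover have "S \<subseteq> {x. a \<bullet> x > b - ?\<eta> * norm a}"
      proof
        fix s assume "s \<in> S"
        then obtain t where t: "t \<in> T" "dist s t \<le> ?\<eta>" by (rule infdist_attained_close[OF S T])
        have "a \<bullet> (t - s) \<le> norm a * norm (t - s)" by (rule norm_cauchy_schwarz)
        also have "\<dots> \<le> norm a * ?\<eta>"
          using t by (intro mult_left_mono) (auto simp: dist_norm norm_minus_commute)
        finally show "s \<in> {x. a \<bullet> x > b - ?\<eta> * norm a}"
          using ab(2)[OF hull_inc[OF t(1)]] by (simp add: inner_diff_right mult.commute)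
      qed
      then have "convex hull S \<subseteq> {x. a \<bullet> x > b - ?\<eta> * norm a}"
        by (intro hull_minimal convex_halfspace_gt)
      ultimately have "a \<bullet> q' > b - ?\<eta> * norm a" by blast
      moreover have "a \<bullet> q' = a \<bullet> q - ?\<eta> * norm a"
        using \<open>a \<noteq> 0\<close> by (simp add: q'_def inner_diff_right dot_square_norm power2_eq_square)
      ultimately show False using ab(1) by simp
    qed
  qed
  moreover have "p \<in> ball p (\<rho> - ?\<eta>)" using less by simp
  ultimately show ?thesis by (meson interiorI open_ball)
qed

text \<open>Write z as a convex combination of at most DIM + 1 points and let \<open>p\<close> carry
  the largest weight. Shifting the weight \<open>u q\<close> between \<open>p\<close> and another
  point \<open>q\<close>, in either direction, leaves all weights nonnegative and moves z by
  \<open>u q\<close> times q - p. If \<open>q\<close> maximises the length of this shift, then z -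
  p, which is the sum of all vectors u v (v - p), is at most DIM + 1 times as long, and
  \<open>p\<close> lies in \<open>K\<close>.\<close>

lemma convex_hull_long_segment:
  fixes K :: "'a::euclidean_space set"
  assumes z: "z \<in> convex hull K"
  obtains l where "z + l \<in> convex hull K" "z - l \<in> convex hull K"
    "infdist z K \<le> (DIM('a) + 1) * norm l"
proof -
  obtain S u where S: "finite S" "S \<subseteq> K" "card S \<le> DIM('a) + 1" "\<And>x. x \<in> S \<Longrightarrow> 0 \<le> u x"
      "sum u S = 1" "(\<Sum>v\<in>S. u v *\<^sub>R v) = z"
    using z unfolding convex_hull_caratheodory[of K] by blast
  have ne: "S \<noteq> {}" using S(5) by auto
  have "Max (u ` S) \<in> u ` S" using S(1) ne by (intro Max_in) auto
  then obtain p where p: "p \<in> S" "u p = Max (u ` S)" by force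
  have p_max: "u x \<le> u p" if "x \<in> S" for x using S(1) that by (simp add: p(2))
  define m where "m = (MAX q\<in>S. u q * norm (q - p))"
  have m: "u q * norm (q - p) \<le> m" if "q \<in> S" for q
    unfolding m_def using S(1) that by simp
  have "m \<in> (\<lambda>q. u q * norm (q - p)) ` S" unfolding m_def using S(1) ne by (intro Max_in) auto
  then obtain q where q: "q \<in> S" "m = u q * norm (q - p)" by auto
  define l where "l = u q *\<^sub>R (q - p)"
  have l: "norm l = m" using q S(4) by (simp add: l_def)
  have "z - p = (\<Sum>v\<in>S. u v *\<^sub>R (v - p))"
    using S(5,6) by (simp add: scaleR_diff_right sum_subtractf flip: scaleR_sum_left)
  then have "norm (z - p) \<le> (\<Sum>v\<in>S. norm (u v *\<^sub>R (v - p)))" by (metis norm_sum)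
  also have "\<dots> \<le> (\<Sum>v\<in>S. m)" by (intro sum_mono) (use m S(4) in auto)
  also have "\<dots> = card S * m" by simp
  also have "\<dots> \<le> real (DIM('a) + 1) * m"
    using S(3) norm_ge_zero[of l] unfolding l by (intro mult_right_mono) (auto simp del: of_nat_Suc)
  finally have "infdist z K \<le> (DIM('a) + 1) * norm l"
    using infdist_le[of p K z] p(1) S(2) l by (auto simp: dist_norm)
  moreover have "z + s *\<^sub>R l \<in> convex hull K" if s: "s = 1 \<or> s = -1" for s :: real
  proof (cases "q = p")
    case True then show ?thesis using z by (simp add: l_def)
  next
    case False
    \<comment> \<open>For s = -1 the weight of \<open>q\<close> drops to zero; for s = 1 the weight
      of \<open>p\<close> becomes u p - u q, which is nonnegative by the choice of
      \<open>p\<close>.\<close>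
    define u' where "u' v = u v + s * (if v = q then u q else 0) - s * (if v = p then u q else 0)" for v
    have "0 \<le> u' v" if "v \<in> S" for v
      using s p_max[OF q(1)] S(4)[OF that] S(4)[OF q(1)] False by (auto simp: u'_def)
    moreover have "sum u' S = 1"
      using S(1,5) p(1) q(1) unfolding u'_def by (simp add: sum.distrib sum_subtractf flip: sum_distrib_left)
    moreover have "(\<Sum>v\<in>S. u' v *\<^sub>R v) = z + s *\<^sub>R l"
    proof -
      have "(\<Sum>v\<in>S. u' v *\<^sub>R v) = (\<Sum>v\<in>S. u v *\<^sub>R v + (if v = q then (s * u q) *\<^sub>R v else 0)
              - (if v = p then (s * u q) *\<^sub>R v else 0))"
        by (intro sum.cong) (auto simp: u'_def algebra_simps)
      also have "\<dots> = z + (s * u q) *\<^sub>R q - (s * u q) *\<^sub>R p"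
        using S(1,6) p(1) q(1) by (simp add: sum.distrib sum_subtractf)
      finally show ?thesis by (simp add: l_def algebra_simps)
    qed
    ultimately have "z + s *\<^sub>R l \<in> convex hull S"
      unfolding convex_hull_finite[OF S(1)] by blast
    then show ?thesis using hull_mono[OF S(2)] by blast
  qed
  from this[of 1] this[of "-1"] have "z + l \<in> convex hull K" "z - l \<in> convex hull K" by auto
  ultimately show ?thesis using that by blast
qed

text \<open>Halving \<open>l\<close> pulls both ends of the segment into the interior, since z
  itself is interior. The admissible directions then form an open set around l/2, in which density
  finds a member of \<open>\<Lambda>\<close>. Staying within |l|/4 of l/2 keeps its length at least
  |l|/4, which is the origin of the factor 4.\<close>

lemma dense_direction_in_convex_hull:
  fixes K :: "'a::euclidean_space set"
  assumes z: "z \<in> interior (convex hull K)" and dense: "closure \<Lambda> = UNIV"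
  obtains zb where "zb \<in> \<Lambda>" "z + zb \<in> interior (convex hull K)" "z - zb \<in> interior (convex hull K)"
    "infdist z K \<le> 4 * (DIM('a) + 1) * norm zb"
proof -
  let ?C = "convex hull K"
  obtain l where l: "z + l \<in> ?C" "z - l \<in> ?C" "infdist z K \<le> (DIM('a) + 1) * norm l"
    using convex_hull_long_segment[OF subsetD[OF interior_subset z]] by metis
  have half: "z + (1/2) *\<^sub>R l \<in> interior ?C" "z - (1/2) *\<^sub>R l \<in> interior ?C"
  proof -
    have "z + l - (1/2) *\<^sub>R (z + l - z) = z + (1/2) *\<^sub>R l"
      "z - l - (1/2) *\<^sub>R (z - l - z) = z - (1/2) *\<^sub>R l"
      by (simp_all add: vec_eq_iff euclidean_eq_iff[where 'a='a] inner_simps)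
    moreover have "z + l - (1/2) *\<^sub>R (z + l - z) \<in> interior ?C"
      "z - l - (1/2) *\<^sub>R (z - l - z) \<in> interior ?C"
      using z l by (intro mem_interior_convex_shrink convex_convex_hull; simp)+
    ultimately show "z + (1/2) *\<^sub>R l \<in> interior ?C" "z - (1/2) *\<^sub>R l \<in> interior ?C"
      by metis+
  qed
  let ?O = "{v. z + v \<in> interior ?C} \<inter> {v. z - v \<in> interior ?C}"
  have "open ((\<lambda>v. z + v) -` interior ?C)" "open ((\<lambda>v. z - v) -` interior ?C)"
    by (intro open_vimage open_interior continuous_intros)+
  then have O: "open ?O" unfolding vimage_def by blast
  show ?thesis
  proof (cases "l = 0")
    \<comment> \<open>Here the distance from z to \<open>K\<close> is zero, so any element of
      \<open>\<Lambda>\<close> close enough to 0 serves, possibly 0 itself.\<close>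
    case True
    have "0 \<in> ?O" using z by simp
    then have "?O \<noteq> {}" by blast
    then have "\<Lambda> \<inter> ?O \<noteq> {}"
      using O dense open_Int_closure_eq_empty[of ?O \<Lambda>] by auto
    then obtain zb where "zb \<in> \<Lambda>" "zb \<in> ?O" by blast
    moreover have "infdist z K \<le> 4 * (DIM('a) + 1) * norm zb"
      using l(3) True by (simp add: order_trans[of _ 0])
    ultimately show ?thesis using that by blast
  next
    case False
    let ?B = "?O \<inter> ball ((1/2) *\<^sub>R l) (norm l / 4)"
    have "(1/2) *\<^sub>R l \<in> ?B" using half False by auto
    moreover have "open ?B" using O by blast
    ultimately have "\<Lambda> \<inter> ?B \<noteq> {}"
      using dense open_Int_closure_eq_empty[of ?B \<Lambda>] by auto
    then obtain zb where zb: "zb \<in> \<Lambda>" "zb \<in> ?O" "zb \<in> ball ((1/2) *\<^sub>R l) (norm l / 4)" by blast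
    have "norm ((1/2) *\<^sub>R l) \<le> norm ((1/2) *\<^sub>R l - zb) + norm zb" by norm
    then have "norm l \<le> 4 * norm zb" using zb(3) by (simp add: dist_norm)
    then have "(DIM('a) + 1) * norm l \<le> (DIM('a) + 1) * (4 * norm zb)" by (intro mult_left_mono) auto
    then have "infdist z K \<le> 4 * (DIM('a) + 1) * norm zb" using l(3) by (simp add: mult_ac)
    then show ?thesis using that zb by blast
  qed
qed


section \<open>Compactly supported waves\<close>

lemma continuous_bounded_support:
  fixes f :: "'a::euclidean_space \<Rightarrow> 'b::euclidean_space"
  assumes f: "continuous_on UNIV f" and supp: "\<And>x. x \<notin> S \<Longrightarrow> f x = 0" and S: "bounded S"
  shows "integrable lebesgue f" and "bounded (range f)"
proof -
  obtain R where R: "S \<subseteq> cball 0 R" using bounded_subset_ballD[OF S, of 0] ball_subset_cball[of 0] by (metis order_trans)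
  have f0: "f x = 0" if "x \<notin> cball 0 R" for x using R supp that by blast
  have "(\<lambda>x. indicator (cball 0 R) x *\<^sub>R f x) = f" using f0 by (force simp: indicator_def)
  then have "integrable lborel f"
    using borel_integrable_compact[of "cball 0 R" f] continuous_on_subset[OF f] by simp
  then show "integrable lebesgue f" by (rule integrable_completion[THEN iffD2, rotated])
      (simp add: borel_measurable_continuous_onI[OF f])
  have "compact (f ` cball 0 R)" by (intro compact_continuous_image continuous_on_subset[OF f]) auto
  then have "bounded (insert 0 (f ` cball 0 R))" by (simp add: compact_imp_bounded)
  moreover have "range f \<subseteq> insert 0 (f ` cball 0 R)" using f0 by blast
  ultimately show "bounded (range f)" using bounded_subset by blast
qed

section \<open>Change of variables and integration by parts on the whole space\<close>

lemma integral_lebesgue_translation: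
  fixes f :: "'a::euclidean_space \<Rightarrow> 'b::euclidean_space"
  assumes "f \<in> borel_measurable borel"
  shows "(\<integral>x. f (a + x) \<partial>lebesgue) = (\<integral>x. f x \<partial>lebesgue)"
proof -
  have "(\<integral>x. f (a + x) \<partial>lebesgue) = (\<integral>x. f (a + x) \<partial>lborel)"
    using assms by (intro integral_completion) simp
  also have "\<dots> = (\<integral>x. f x \<partial>distr lborel borel ((+) a))"
    using assms by (subst integral_distr) auto
  also have "\<dots> = (\<integral>x. f x \<partial>lebesgue)"
    using assms by (simp add: lborel_distr_plus integral_completion)
  finally show ?thesis .
qed

lemma integral_lebesgue_affine:
  fixes f :: "'a::euclidean_space \<Rightarrow> 'b::euclidean_space"
  assumes f: "f \<in> borel_measurable borel" and r: "r > 0"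
  shows "(\<integral>x. f ((1/r) *\<^sub>R (x - a)) \<partial>lebesgue) = r ^ DIM('a) *\<^sub>R (\<integral>x. f x \<partial>lebesgue)"
proof -
  have [measurable]: "(\<lambda>x. f ((1/r) *\<^sub>R (x - a))) \<in> borel_measurable borel"
    using f by (rule measurable_compose[rotated]) measurable
  \<comment> \<open>\<open>lborel_affine_euclidean\<close> scales each coordinate by its own factor;
    with equal factors its sum over \<open>Basis\<close> collapses to a + r x.\<close>
  let ?T = "\<lambda>x. a + (\<Sum>j\<in>Basis. (r * (x \<bullet> j)) *\<^sub>R j)"
  have T: "?T = (\<lambda>x. a + r *\<^sub>R x)"
  proof
    fix x :: 'a
    have "(\<Sum>j\<in>Basis. (r * (x \<bullet> j)) *\<^sub>R j) = r *\<^sub>R (\<Sum>j\<in>Basis. (x \<bullet> j) *\<^sub>R j)"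
      by (simp add: scaleR_sum_right)
    then show "?T x = a + r *\<^sub>R x" by (simp add: euclidean_representation)
  qed
  have lb: "lborel = density (distr lborel borel (\<lambda>x. a + r *\<^sub>R x)) (\<lambda>_. r ^ DIM('a))"
    using lborel_affine_euclidean[of "\<lambda>_. r" a] r unfolding T by simp
  have "(\<integral>x. f ((1/r) *\<^sub>R (x - a)) \<partial>lebesgue) = (\<integral>x. f ((1/r) *\<^sub>R (x - a)) \<partial>lborel)"
    by (intro integral_completion) simp
  also have "\<dots> = (\<integral>x. r ^ DIM('a) *\<^sub>R f ((1/r) *\<^sub>R (a + r *\<^sub>R x - a)) \<partial>lborel)"
    using r by (subst lb, subst integral_density) (simp_all add: integral_distr)
  also have "\<dots> = r ^ DIM('a) *\<^sub>R (\<integral>x. f x \<partial>lebesgue)"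
    using f r by (simp add: integral_completion)
  finally show ?thesis .
qed

lemma has_derivative_frechet_derivative:
  assumes "f differentiable (at x)"
  shows "(f has_derivative frechet_derivative f (at x)) (at x)"
  using assms by (simp add: frechet_derivative_works)

lemma partial_deriv_eq:
  assumes "(f has_derivative f') (at x)"
  shows "partial_deriv i f x = f' (axis i 1)"
  using frechet_derivative_at[OF assms] by (simp add: partial_deriv_def)

lemma has_vector_derivative_along_axis:
  assumes "f differentiable (at (x + t *\<^sub>R axis i 1))"
  shows "((\<lambda>t. f (x + t *\<^sub>R axis i 1)) has_vector_derivative
           partial_deriv i f (x + t *\<^sub>R axis i 1)) (at t within T)"
proof -
  have "((\<lambda>t. f (x + t *\<^sub>R axis i 1)) has_derivative
          (\<lambda>s. frechet_derivative f (at (x + t *\<^sub>R axis i 1)) (s *\<^sub>R axis i 1))) (at t within T)"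
    by (rule has_derivative_compose[where f = "\<lambda>t. x + t *\<^sub>R axis i 1" and f' = "\<lambda>s. s *\<^sub>R axis i 1",
          OF _ has_derivative_frechet_derivative[OF assms]]) (auto intro!: derivative_eq_intros)
  moreover have "linear (frechet_derivative f (at (x + t *\<^sub>R axis i 1)))"
    using assms by (rule linear_frechet_derivative)
  ultimately show ?thesis
    by (simp add: has_vector_derivative_def partial_deriv_def linear_scale)
qed

text \<open>Translation invariance makes the integral of every difference quotient vanish.\<close>

lemma has_bochner_integral_partial_deriv:
  fixes f :: "real^'d::finite \<Rightarrow> 'b::euclidean_space"
  assumes diff: "\<And>x. f differentiable (at x)" and cont: "continuous_on UNIV (partial_deriv i f)"
    and supp: "\<And>x. x \<notin> S \<Longrightarrow> f x = 0" and S: "bounded S"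
  shows "has_bochner_integral lebesgue (partial_deriv i f) 0"
proof -
  let ?e = "axis i 1 :: real^'d"
  define t :: "nat \<Rightarrow> real" where "t n = 1 / Suc n" for n
  have t: "0 < t n" "t n \<le> 1" for n by (auto simp: t_def)
  have t0: "t \<longlonglongrightarrow> 0" unfolding t_def by (rule LIMSEQ_Suc[OF lim_1_over_n])
  define q where "q n x = (1 / t n) *\<^sub>R (f (x + t n *\<^sub>R ?e) - f x)" for n x
  obtain R where R: "S \<subseteq> cball 0 R" using bounded_subset_ballD[OF S, of 0] ball_subset_cball[of 0] by (metis order_trans)
  have f0: "f x = 0" if "norm x > R" for x
    using R that by (intro supp) (auto simp: subset_iff)
  have contf: "continuous_on UNIV f"
    using diff by (simp add: differentiable_imp_continuous_within continuous_on_eq_continuous_at)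
  have "bounded (partial_deriv i f ` cball 0 (R + 2))"
    by (intro compact_imp_bounded compact_continuous_image continuous_on_subset[OF cont]) auto
  then obtain B where "\<forall>y\<in>partial_deriv i f ` cball 0 (R + 2). norm y \<le> B"
    unfolding bounded_iff by (elim exE)
  then have B: "norm (partial_deriv i f x) \<le> B" if "norm x \<le> R + 2" for x using that by simp
  have shift: "norm (x + s *\<^sub>R ?e) \<le> norm x + \<bar>s\<bar>" "norm x - \<bar>s\<bar> \<le> norm (x + s *\<^sub>R ?e)" for x s
    using norm_triangle_ineq[of x "s *\<^sub>R ?e"] norm_diff_ineq[of x "s *\<^sub>R ?e"] by auto
  \<comment> \<open>The mean value inequality along the axis yields a majorant independent of
    \<open>n\<close>. Shifts have length at most 1, so the quotients vanish for |x| > R + 1, and for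
    the other x the intermediate point stays in the ball of radius R + 2 on which \<open>B\<close>
    was taken.\<close>
  have q_le: "norm (q n x) \<le> indicator (cball 0 (R + 1)) x * B" for n x
  proof (cases "norm x \<le> R + 1")
    case False
    then have "f x = 0" "f (x + t n *\<^sub>R ?e) = 0"
      using f0 shift(2)[of x "t n"] t[of n] by auto
    then show ?thesis using False by (simp add: q_def)
  next
    case True
    have "\<exists>s\<in>{0<..<t n}. norm (f (x + t n *\<^sub>R ?e) - f (x + 0 *\<^sub>R ?e))
        \<le> norm ((t n - 0) *\<^sub>R partial_deriv i f (x + s *\<^sub>R ?e))"
    proof (rule mvt_general[where f = "\<lambda>s. f (x + s *\<^sub>R ?e)"])
      show "continuous_on {0..t n} (\<lambda>s. f (x + s *\<^sub>R ?e))"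
        by (intro continuous_on_compose2[OF contf] continuous_intros) auto
      show "((\<lambda>s. f (x + s *\<^sub>R ?e)) has_derivative (\<lambda>h. h *\<^sub>R partial_deriv i f (x + s *\<^sub>R ?e))) (at s)" for s
        using has_vector_derivative_along_axis[of f x s i UNIV] diff by (simp add: has_vector_derivative_def)
    qed (rule t)
    then obtain s where s: "0 < s" "s < t n"
        "norm (f (x + t n *\<^sub>R ?e) - f x) \<le> t n * norm (partial_deriv i f (x + s *\<^sub>R ?e))"
      using t[of n] by (fastforce simp: abs_of_pos)
    have "norm (partial_deriv i f (x + s *\<^sub>R ?e)) \<le> B"
      using shift(1)[of x s] True t[of n] s by (intro B) auto
    then have "t n * norm (partial_deriv i f (x + s *\<^sub>R ?e)) \<le> t n * B"
      using t[of n] by (intro mult_left_mono) auto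
    with s(3) have "norm (f (x + t n *\<^sub>R ?e) - f x) \<le> t n * B" by (rule order_trans)
    moreover have "norm (q n x) = norm (f (x + t n *\<^sub>R ?e) - f x) / t n"
      using t[of n] by (simp add: q_def)
    ultimately show ?thesis using t[of n] True by (simp add: pos_divide_le_eq mult.commute)
  qed
  have q_lim: "(\<lambda>n. q n x) \<longlonglongrightarrow> partial_deriv i f x" for x
  proof -
    have "((\<lambda>s. f (x + s *\<^sub>R ?e)) has_vector_derivative partial_deriv i f x) (at 0)"
      using has_vector_derivative_along_axis[of f x 0 i UNIV] diff by simp
    then have "((\<lambda>h. norm (f (x + h *\<^sub>R ?e) - f x - h *\<^sub>R partial_deriv i f x) / norm h) \<longlongrightarrow> 0) (at 0)"
      by (simp add: has_vector_derivative_def has_derivative_at)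
    moreover have "filterlim t (at 0) sequentially"
      using t t0 by (auto simp: filterlim_at intro!: always_eventually less_imp_neq[THEN not_sym])
    ultimately have "(\<lambda>n. norm (f (x + t n *\<^sub>R ?e) - f x - t n *\<^sub>R partial_deriv i f x) / norm (t n)) \<longlonglongrightarrow> 0"
      by (rule filterlim_compose)
    moreover have "norm (f (x + t n *\<^sub>R ?e) - f x - t n *\<^sub>R partial_deriv i f x) / norm (t n)
        = norm (q n x - partial_deriv i f x)" for n
    proof -
      have "q n x - partial_deriv i f x
          = (1 / t n) *\<^sub>R (f (x + t n *\<^sub>R ?e) - f x - t n *\<^sub>R partial_deriv i f x)"
        using t[of n] by (simp add: q_def scaleR_diff_right)
      then show ?thesis using t[of n] by simp
    qed
    ultimately have "(\<lambda>n. norm (q n x - partial_deriv i f x)) \<longlonglongrightarrow> 0" by simp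
    then show ?thesis by (rule LIM_zero_cancel[OF tendsto_norm_zero_cancel])
  qed
  have q_int: "(\<integral>x. q n x \<partial>lebesgue) = 0" for n
  proof -
    have I: "integrable lebesgue f" by (rule continuous_bounded_support(1)[OF contf supp S])
    have "continuous_on UNIV (\<lambda>x. f (t n *\<^sub>R ?e + x))"
      by (intro continuous_on_compose2[OF contf] continuous_intros) auto
    then have I': "integrable lebesgue (\<lambda>x. f (t n *\<^sub>R ?e + x))"
    proof (rule continuous_bounded_support(1))
      show "f (t n *\<^sub>R ?e + x) = 0" if "x \<notin> cball 0 (R + 1)" for x
        using that f0 shift(2)[of x "t n"] t[of n] by (auto simp: add.commute)
    qed auto
    have "(\<integral>x. f (t n *\<^sub>R ?e + x) \<partial>lebesgue) = (\<integral>x. f x \<partial>lebesgue)"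
      by (intro integral_lebesgue_translation borel_measurable_continuous_onI contf)
    then show ?thesis using I I' by (simp add: q_def add.commute)
  qed
  have meas: "partial_deriv i f \<in> borel_measurable lebesgue"
    using continuous_imp_measurable_on_sets_lebesgue[OF cont] by simp
  have "continuous_on UNIV (q n)" for n
    unfolding q_def by (intro continuous_intros continuous_on_compose2[OF contf]) auto
  then have q_meas: "q n \<in> borel_measurable lebesgue" for n
    using continuous_imp_measurable_on_sets_lebesgue[of UNIV "q n"] by simp
  have dom: "integrable lebesgue (\<lambda>x::real^'d. indicator (cball 0 (R + 1)) x * B)"
    using emeasure_lborel_cball_finite[of "0::real^'d" "R + 1"]
    by (intro integrable_mult_left integrable_real_indicator) simp_all
  have "integrable lebesgue (partial_deriv i f)"
    by (rule integrable_dominated_convergence[where s = q, OF meas q_meas dom]) (use q_le q_lim in auto)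
  moreover have "(\<lambda>n. \<integral>x. q n x \<partial>lebesgue) \<longlonglongrightarrow> (\<integral>x. partial_deriv i f x \<partial>lebesgue)"
    by (rule integral_dominated_convergence[where s = q, OF meas q_meas dom]) (use q_le q_lim in auto)
  ultimately show ?thesis by (simp add: q_int LIMSEQ_const_iff has_bochner_integral_iff)
qed

lemma test_functionsD:
  assumes "\<phi> \<in> test_functions \<Omega>"
  shows "\<phi> differentiable (at x)" "continuous_on UNIV (partial_deriv i \<phi>)" "continuous_on UNIV \<phi>"
    "\<phi> \<in> test_functions UNIV" "x \<notin> \<Omega> \<Longrightarrow> \<phi> x = 0"
proof -
  have "Ck 1 \<phi>" "Ck 0 \<phi>" using assms unfolding test_functions_def mem_Collect_eq by metis+
  then show "\<phi> differentiable (at x)" "continuous_on UNIV (partial_deriv i \<phi>)" "continuous_on UNIV \<phi>" by simp_all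
  show "\<phi> \<in> test_functions UNIV" using assms by (simp add: test_functions_def)
  show "\<phi> x = 0" if "x \<notin> \<Omega>"
    using assms that closure_subset[of "{x. \<phi> x \<noteq> 0}"] by (auto simp: test_functions_def)
qed

lemma continuous_on_matrix_vector_mult [continuous_intros]:
  fixes M :: "real^'n::finite^'m::finite"
  assumes "continuous_on S f" shows "continuous_on S (\<lambda>x. M *v f x)"
  using bounded_linear.continuous_on[OF matrix_vector_mul_bounded_linear[of M] assms] .

text \<open>By the product rule the integrand is the sum of the derivatives of
  \<open>\<phi> x *\<^sub>R (A i *v v x)\<close> minus \<phi> times the left side of the pointwise
  equation, which is zero. The bounded support of \<open>v\<close> makes the integral of each of
  those derivatives vanish.\<close>

lemma integral_test_compact_solution_eq_0:
  fixes A :: "'d::finite \<Rightarrow> real^'n::finite^'m::finite" and \<phi> :: "real^'d \<Rightarrow> real"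
  assumes \<phi>: "\<And>x. \<phi> differentiable (at x)" "\<And>i. continuous_on UNIV (partial_deriv i \<phi>)"
    and v: "\<And>x. v differentiable (at x)" "\<And>i. continuous_on UNIV (partial_deriv i v)"
    and supp: "\<And>x. x \<notin> S \<Longrightarrow> v x = 0" and S: "bounded S"
    and sol: "\<And>x. (\<Sum>i\<in>UNIV. A i *v partial_deriv i v x) = 0"
  shows "(\<integral>x. (\<Sum>i\<in>UNIV. partial_deriv i \<phi> x *\<^sub>R (A i *v v x)) \<partial>lebesgue) = 0"
proof -
  define H where "H i x = \<phi> x *\<^sub>R (A i *v v x)" for i x
  have cont: "continuous_on UNIV \<phi>" "continuous_on UNIV v"
    using \<phi>(1) v(1) by (simp_all add: differentiable_imp_continuous_within continuous_on_eq_continuous_at)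
  have der: "(H i has_derivative (\<lambda>h. \<phi> x *\<^sub>R (A i *v frechet_derivative v (at x) h)
      + frechet_derivative \<phi> (at x) h *\<^sub>R (A i *v v x))) (at x)" for i x
    unfolding H_def
    by (intro has_derivative_scaleR has_derivative_frechet_derivative[OF \<phi>(1)]
        bounded_linear.has_derivative[OF matrix_vector_mul_bounded_linear]
        has_derivative_frechet_derivative[OF v(1)])
  have pd: "partial_deriv i (H i) = (\<lambda>x. \<phi> x *\<^sub>R (A i *v partial_deriv i v x)
      + partial_deriv i \<phi> x *\<^sub>R (A i *v v x))" for i
    using partial_deriv_eq[OF der] by (auto simp: partial_deriv_def)
  have "has_bochner_integral lebesgue (partial_deriv i (H i)) 0" for i
  proof (rule has_bochner_integral_partial_deriv)
    show "H i differentiable (at x)" for x using der differentiableI by blast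
    show "continuous_on UNIV (partial_deriv i (H i))"
      unfolding pd by (intro continuous_intros cont \<phi>(2) v(2))
  qed (use supp S in \<open>auto simp: H_def\<close>)
  then have "has_bochner_integral lebesgue (\<lambda>x. \<Sum>i\<in>UNIV. partial_deriv i (H i) x) (\<Sum>i\<in>(UNIV::'d set). 0)"
    by (intro has_bochner_integral_sum)
  moreover have "(\<Sum>i\<in>UNIV. partial_deriv i (H i) x) = (\<Sum>i\<in>UNIV. partial_deriv i \<phi> x *\<^sub>R (A i *v v x))" for x
    unfolding pd using sol[of x] by (simp add: sum.distrib flip: scaleR_sum_right)
  ultimately show ?thesis by (simp add: has_bochner_integral_iff)
qed

text \<open>Smoothness of the waves is dropped on purpose: only continuity, the support and the weak
  equation are used later, and these are stable under finite sums, scaling and enlarging the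
  support. Testing with \<open>test_functions UNIV\<close> rather than with functions supported in
  \<open>S\<close> says that the extension by zero is a solution across the boundary of
  \<open>S\<close> as well.\<close>

definition oscillation ::
    "('d::finite \<Rightarrow> real^'n::finite^'m::finite) \<Rightarrow> (real^'d) set \<Rightarrow> (real^'d \<Rightarrow> real^'n) \<Rightarrow> bool"
  where "oscillation A S v \<longleftrightarrow> continuous_on UNIV v \<and> (\<forall>x. x \<notin> S \<longrightarrow> v x = 0) \<and>
    (\<forall>\<phi> \<in> test_functions UNIV.
       (\<integral>x. (\<Sum>i\<in>UNIV. partial_deriv i \<phi> x *\<^sub>R (A i *v v x)) \<partial>lebesgue) = 0)"

lemma oscillation_mono: "oscillation A S v \<Longrightarrow> S \<subseteq> T \<Longrightarrow> oscillation A T v"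
  by (auto simp: oscillation_def)

lemma oscillation_integrable:
  fixes A :: "'d::finite \<Rightarrow> real^'n::finite^'m::finite" and \<phi> :: "real^'d \<Rightarrow> real"
  assumes v: "oscillation A S v" and S: "bounded S" and \<phi>: "\<phi> \<in> test_functions UNIV"
  shows "integrable lebesgue (\<lambda>x. \<Sum>i\<in>UNIV. partial_deriv i \<phi> x *\<^sub>R (A i *v v x))"
proof (rule continuous_bounded_support(1)[OF _ _ S])
  show "continuous_on UNIV (\<lambda>x. \<Sum>i\<in>UNIV. partial_deriv i \<phi> x *\<^sub>R (A i *v v x))"
    using v by (intro continuous_intros test_functionsD[OF \<phi>]) (auto simp: oscillation_def)
qed (use v in \<open>simp add: oscillation_def\<close>)

lemma oscillation_scaleR:
  assumes v: "oscillation A S v"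
  shows "oscillation A S (\<lambda>x. t *\<^sub>R v x)"
proof -
  have "(\<integral>x. (\<Sum>i\<in>UNIV. partial_deriv i \<phi> x *\<^sub>R (A i *v (t *\<^sub>R v x))) \<partial>lebesgue) = 0"
    if "\<phi> \<in> test_functions UNIV" for \<phi>
  proof -
    have "(\<Sum>i\<in>UNIV. partial_deriv i \<phi> x *\<^sub>R (A i *v (t *\<^sub>R v x)))
        = t *\<^sub>R (\<Sum>i\<in>UNIV. partial_deriv i \<phi> x *\<^sub>R (A i *v v x))" for x
      by (simp add: matrix_vector_mult_scaleR scaleR_sum_right mult.commute)
    then show ?thesis using v that by (simp add: oscillation_def)
  qed
  then show ?thesis using v by (auto simp: oscillation_def intro!: continuous_intros)
qed

lemma oscillation_sum:
  assumes v: "\<And>j. j \<in> J \<Longrightarrow> oscillation A S (v j)" and S: "bounded S"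
  shows "oscillation A S (\<lambda>x. \<Sum>j\<in>J. v j x)"
proof -
  have "(\<integral>x. (\<Sum>i\<in>UNIV. partial_deriv i \<phi> x *\<^sub>R (A i *v (\<Sum>j\<in>J. v j x))) \<partial>lebesgue) = 0"
    if \<phi>: "\<phi> \<in> test_functions UNIV" for \<phi>
  proof -
    have "(\<Sum>i\<in>UNIV. partial_deriv i \<phi> x *\<^sub>R (A i *v (\<Sum>j\<in>J. v j x)))
        = (\<Sum>j\<in>J. \<Sum>i\<in>UNIV. partial_deriv i \<phi> x *\<^sub>R (A i *v v j x))" for x
      by (subst sum.swap) (simp add: linear_sum[OF matrix_vector_mul_linear] scaleR_sum_right)
    moreover have "integrable lebesgue (\<lambda>x. \<Sum>i\<in>UNIV. partial_deriv i \<phi> x *\<^sub>R (A i *v v j x))" if "j \<in> J" for j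
      by (rule oscillation_integrable[OF v[OF that] S \<phi>])
    ultimately show ?thesis
      using v \<phi> by (simp add: Bochner_Integration.integral_sum oscillation_def)
  qed
  then show ?thesis using v by (auto simp: oscillation_def intro!: continuous_intros)
qed

lemma integral_restrict_support:
  fixes f :: "'a::euclidean_space \<Rightarrow> 'b::{banach, second_countable_topology}"
  assumes "\<And>x. x \<notin> S \<Longrightarrow> f x = 0" "S \<in> sets lebesgue"
  shows "(\<integral>x. f x \<partial>lebesgue_on S) = (\<integral>x. f x \<partial>lebesgue)"
proof -
  have "indicator S x *\<^sub>R f x = f x" for x using assms(1) by (cases "x \<in> S") auto
  then show ?thesis using assms(2) by (simp add: integral_restrict_space)
qed

lemma integrable_continuous_bounded:
  fixes f :: "'a::euclidean_space \<Rightarrow> 'b::euclidean_space"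
  assumes f: "continuous_on S f" "bounded (f ` S)" and S: "S \<in> lmeasurable"
  shows "integrable (lebesgue_on S) f"
proof -
  interpret finite_measure "lebesgue_on S" using S by (rule finite_measure_lebesgue_on)
  have "f \<in> borel_measurable (lebesgue_on S)"
    using f(1) S by (intro continuous_imp_measurable_on_sets_lebesgue fmeasurableD)
  moreover obtain B where "\<And>x. x \<in> S \<Longrightarrow> norm (f x) \<le> B" using f(2) by (metis bounded_iff imageI)
  ultimately show ?thesis by (intro integrable_const_bound[where B = B]) (auto intro!: AE_I2)
qed

lemma L2_continuous_bounded:
  assumes g: "continuous_on S g" "bounded (g ` S)" and S: "S \<in> lmeasurable"
  shows "g \<in> L2 S"
proof -
  obtain B where "\<forall>y\<in>g ` S. norm y \<le> B" using g(2) unfolding bounded_iff by (elim exE)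
  then have "bounded ((\<lambda>x. (norm (g x))\<^sup>2) ` S)"
    unfolding bounded_iff by (intro exI[of _ "B\<^sup>2"]) (auto intro: power_mono)
  then have "integrable (lebesgue_on S) (\<lambda>x. (norm (g x))\<^sup>2)"
    using g(1) S by (intro integrable_continuous_bounded continuous_intros)
  moreover have "g \<in> borel_measurable (lebesgue_on S)"
    using g(1) S by (intro continuous_imp_measurable_on_sets_lebesgue fmeasurableD)
  ultimately show ?thesis by (simp add: L2_def)
qed

lemma rescale_mem_unit_ball_iff:
  fixes y :: "'a::real_normed_vector"
  assumes "r > 0"
  shows "(1/r) *\<^sub>R (y - a) \<in> ball 0 1 \<longleftrightarrow> y \<in> ball a r"
proof -
  have "norm ((1/r) *\<^sub>R (y - a)) = norm (y - a) / r" using assms by simp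
  then show ?thesis
    using assms by (simp add: dist_norm norm_minus_commute[of a y] del: norm_scaleR scaleR_diff_right)
qed

text \<open>The system has constant coefficients and only first order terms, so the change of
  variables multiplies its left side by 1/r.\<close>

lemma oscillation_rescaled:
  fixes A :: "'d::finite \<Rightarrow> real^'n::finite^'m::finite"
  assumes w: "w \<in> test_functions (ball 0 1)" and sol: "\<And>x. (\<Sum>i\<in>UNIV. A i *v partial_deriv i w x) = 0"
    and r: "r > 0"
  shows "oscillation A (ball a r) (\<lambda>y. w ((1/r) *\<^sub>R (y - a)))"
proof -
  define v where "v y = w ((1/r) *\<^sub>R (y - a))" for y
  have supp: "v y = 0" if "y \<notin> ball a r" for y
    unfolding v_def
  proof (rule test_functionsD(5)[OF w])
    show "(1/r) *\<^sub>R (y - a) \<notin> ball 0 1" using that rescale_mem_unit_ball_iff[OF r] by blast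
  qed
  have der: "(v has_derivative (\<lambda>h. frechet_derivative w (at ((1/r) *\<^sub>R (y - a))) ((1/r) *\<^sub>R h))) (at y)" for y
    unfolding v_def
    by (rule has_derivative_compose[where f = "\<lambda>y. (1/r) *\<^sub>R (y - a)" and f' = "\<lambda>h. (1/r) *\<^sub>R h",
          OF _ has_derivative_frechet_derivative[OF test_functionsD(1)[OF w]]])
      (auto intro!: derivative_eq_intros)
  have pd: "partial_deriv i v = (\<lambda>y. (1/r) *\<^sub>R partial_deriv i w ((1/r) *\<^sub>R (y - a)))" for i
  proof
    fix y
    have "linear (frechet_derivative w (at ((1/r) *\<^sub>R (y - a))))"
      using test_functionsD(1)[OF w] by (rule linear_frechet_derivative)
    then show "partial_deriv i v y = (1/r) *\<^sub>R partial_deriv i w ((1/r) *\<^sub>R (y - a))"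
      using partial_deriv_eq[OF der] by (simp add: partial_deriv_def linear_scale)
  qed
  have "(\<integral>x. (\<Sum>i\<in>UNIV. partial_deriv i \<phi> x *\<^sub>R (A i *v v x)) \<partial>lebesgue) = 0"
    if \<phi>: "\<phi> \<in> test_functions UNIV" for \<phi>
  proof (rule integral_test_compact_solution_eq_0[OF test_functionsD(1,2)[OF \<phi>] _ _ supp bounded_ball])
    show "v differentiable (at x)" for x using der differentiableI by blast
    show "continuous_on UNIV (partial_deriv i v)" for i
      unfolding pd
      by (intro continuous_intros continuous_on_compose2[OF test_functionsD(2)[OF w]]) auto
    show "(\<Sum>i\<in>UNIV. A i *v partial_deriv i v x) = 0" for x
      using sol[of "(1/r) *\<^sub>R (x - a)"] unfolding pd
      by (simp add: matrix_vector_mult_scaleR flip: scaleR_sum_right)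
  qed
  moreover have "continuous_on UNIV v"
    unfolding v_def by (intro continuous_intros continuous_on_compose2[OF test_functionsD(3)[OF w]]) auto
  ultimately have "oscillation A (ball a r) v" using supp by (simp add: oscillation_def)
  then show ?thesis by (simp add: v_def[abs_def])
qed

text \<open>The constant must precede all balls and directions, since the perturbation step compares
  energies of waves on many balls at once. As only finitely many functions are tested, one
  sufficiently late member of the given sequence meets all smallness requirements; the energy bound
  holds for every member and picks up the Jacobian of the rescaling.\<close>

lemma wave_cone_localized:
  fixes A :: "'d::finite \<Rightarrow> real^'n::finite^'m::finite"
  assumes "wave_cone A \<Lambda>"
  shows "\<exists>C>0. \<forall>zb\<in>\<Lambda>. \<forall>a r \<rho> \<epsilon> G. 0 < r \<longrightarrow> 0 < \<rho> \<longrightarrow> 0 < \<epsilon> \<longrightarrow> finite G \<longrightarrow>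
      (\<forall>g\<in>G. continuous_on (ball a r) g \<and> bounded (g ` ball a r)) \<longrightarrow>
      (\<exists>v. oscillation A (ball a r) v \<and> (\<forall>x. infdist (v x) (closed_segment (- zb) zb) < \<rho>) \<and>
          (\<forall>g\<in>G. \<bar>\<integral>x. v x \<bullet> g x \<partial>lebesgue\<bar> < \<epsilon>) \<and>
          C * r ^ CARD('d) * (norm zb)\<^sup>2 \<le> (\<integral>x. (norm (v x))\<^sup>2 \<partial>lebesgue))"
proof -
  obtain C where C: "C > 0" "\<forall>zb\<in>\<Lambda>. \<exists>w :: nat \<Rightarrow> real^'d \<Rightarrow> real^'n.
       (\<forall>k. w k \<in> test_functions (ball 0 1) \<and>
            (\<forall>x. (\<Sum>i\<in>UNIV. A i *v partial_deriv i (w k) x) = 0)) \<and>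
       uniform_limit (ball 0 1) (\<lambda>k x. infdist (w k x) (closed_segment (- zb) zb))
         (\<lambda>_. 0) sequentially \<and>
       L2_weakly_tendsto (ball 0 1) w (\<lambda>_. 0) \<and>
       (\<forall>k. (\<integral>y. (norm (w k y))\<^sup>2 \<partial>lebesgue) > C * (norm zb)\<^sup>2)"
    using assms unfolding wave_cone_def by (elim exE conjE)
  show ?thesis
  proof (intro exI[of _ C] conjI C(1) ballI allI impI)
    fix zb :: "real^'n" and a :: "real^'d" and r \<rho> \<epsilon> :: real and G :: "(real^'d \<Rightarrow> real^'n) set"
    assume zb: "zb \<in> \<Lambda>" and r: "0 < r" and \<rho>: "0 < \<rho>" and \<epsilon>: "0 < \<epsilon>" and fin: "finite G"
      and G: "\<forall>g\<in>G. continuous_on (ball a r) g \<and> bounded (g ` ball a r)"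
    let ?B = "ball (0::real^'d) 1"
    let ?seg = "closed_segment (- zb) zb"
    from bspec[OF C(2) zb] obtain w :: "nat \<Rightarrow> real^'d \<Rightarrow> real^'n" where
      "\<forall>k. w k \<in> test_functions ?B \<and> (\<forall>x. (\<Sum>i\<in>UNIV. A i *v partial_deriv i (w k) x) = 0)"
      and unif: "uniform_limit ?B (\<lambda>k x. infdist (w k x) ?seg) (\<lambda>_. 0) sequentially"
      and weak: "L2_weakly_tendsto ?B w (\<lambda>_. 0)"
      and energy: "\<forall>k. (\<integral>y. (norm (w k y))\<^sup>2 \<partial>lebesgue) > C * (norm zb)\<^sup>2"
      by (elim exE conjE)
    then have w: "w k \<in> test_functions ?B" and sol: "(\<Sum>i\<in>UNIV. A i *v partial_deriv i (w k) x) = 0" for k x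
      by simp_all
    define v where "v k y = w k ((1/r) *\<^sub>R (y - a))" for k y
    have osc: "oscillation A (ball a r) (v k)" for k
      unfolding v_def[abs_def] by (rule oscillation_rescaled[OF w sol r])
    have supp: "w k x = 0" if "x \<notin> ?B" for k x by (rule test_functionsD(5)[OF w that])
    have wm [measurable]: "w k \<in> borel_measurable borel" for k
      using test_functionsD(3)[OF w] by (rule borel_measurable_continuous_onI)
    have "\<forall>\<^sub>F k in sequentially. \<forall>x\<in>?B. dist (infdist (w k x) ?seg) 0 < \<rho>"
      using unif \<rho> by (rule uniform_limitD)
    moreover have "\<forall>\<^sub>F k in sequentially. \<forall>g\<in>G. \<bar>\<integral>x. v k x \<bullet> g x \<partial>lebesgue\<bar> < \<epsilon>"
      unfolding eventually_ball_finite_distrib[OF fin]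
    proof
      fix g assume "g \<in> G"
      \<comment> \<open>Testing the rescaled wave against \<open>g\<close> amounts to testing the
        original wave against the pullback of \<open>g\<close> to the unit ball, so the given weak
        convergence applies.\<close>
      define g' where "g' x = g (a + r *\<^sub>R x)" for x
      have img: "(\<lambda>x. a + r *\<^sub>R x) ` ?B \<subseteq> ball a r"
        using r by (auto simp: dist_norm)
      have g: "continuous_on (ball a r) g" "bounded (g ` ball a r)" using bspec[OF G \<open>g \<in> G\<close>] by simp_all
      have g'c: "continuous_on ?B g'"
        unfolding g'_def by (rule continuous_on_compose2[OF g(1) _ img]) (intro continuous_intros)
      have "g' ` ?B \<subseteq> g ` ball a r" unfolding g'_def using img by blast
      with g(2) have "bounded (g' ` ?B)" by (rule bounded_subset)
      with g'c have "g' \<in> L2 ?B" by (intro L2_continuous_bounded) auto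
      then have lim: "(\<lambda>k. \<integral>x. w k x \<bullet> g' x \<partial>lebesgue_on ?B) \<longlonglongrightarrow> 0"
        using weak unfolding L2_weakly_tendsto_def by fastforce
      have g'm [measurable]: "(\<lambda>x. indicator ?B x *\<^sub>R g' x) \<in> borel_measurable borel"
        using g'c by (intro borel_measurable_continuous_on_indicator) auto
      have "(\<integral>x. v k x \<bullet> g x \<partial>lebesgue) = r ^ CARD('d) * (\<integral>x. w k x \<bullet> g' x \<partial>lebesgue_on ?B)" for k
      proof -
        \<comment> \<open>\<open>g\<close> is continuous only on its ball; the indicator turns the
          pullback into a Borel function on the whole space, and the product is unaffected because
          the wave vanishes off the unit ball.\<close>
        define F where "F x = w k x \<bullet> (indicator ?B x *\<^sub>R g' x)" for x
        have F: "F \<in> borel_measurable borel" unfolding F_def by measurable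
        have "v k x \<bullet> g x = F ((1/r) *\<^sub>R (x - a))" for x
        proof (cases "(1/r) *\<^sub>R (x - a) \<in> ?B")
          case True
          then show ?thesis using r by (simp add: v_def g'_def F_def)
        next
          case False
          then show ?thesis using supp[OF False] by (simp add: v_def F_def)
        qed
        then have "(\<integral>x. v k x \<bullet> g x \<partial>lebesgue) = r ^ CARD('d) * (\<integral>x. F x \<partial>lebesgue)"
          using integral_lebesgue_affine[OF F r, of a] by (simp only: DIM_cart DIM_real mult_1_right real_scaleR_def)
        moreover have "(\<integral>x. w k x \<bullet> g' x \<partial>lebesgue_on ?B) = (\<integral>x. F x \<partial>lebesgue)"
          by (simp add: integral_restrict_space F_def)
        ultimately show ?thesis by simp
      qed
      then have "(\<lambda>k. \<integral>x. v k x \<bullet> g x \<partial>lebesgue) \<longlonglongrightarrow> 0"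
        using tendsto_mult_right_zero[OF lim, of "r ^ CARD('d)"] by simp
      then show "\<forall>\<^sub>F k in sequentially. \<bar>\<integral>x. v k x \<bullet> g x \<partial>lebesgue\<bar> < \<epsilon>"
        using tendstoD[OF _ \<epsilon>] by fastforce
    qed
    ultimately have "\<forall>\<^sub>F k in sequentially. (\<forall>x\<in>?B. dist (infdist (w k x) ?seg) 0 < \<rho>) \<and>
        (\<forall>g\<in>G. \<bar>\<integral>x. v k x \<bullet> g x \<partial>lebesgue\<bar> < \<epsilon>)" by (rule eventually_conj)
    from eventually_happens'[OF sequentially_bot this] obtain k where close: "\<forall>x\<in>?B. dist (infdist (w k x) ?seg) 0 < \<rho>"
        and small: "\<forall>g\<in>G. \<bar>\<integral>x. v k x \<bullet> g x \<partial>lebesgue\<bar> < \<epsilon>"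
      by (elim exE conjE)
    have near: "infdist (w k x) ?seg < \<rho>" if "x \<in> ?B" for x
      using bspec[OF close that] by simp
    \<comment> \<open>The segment is symmetric about 0, so the distance bound extends to all points
      outside the ball, where the wave is zero.\<close>
    have "0 \<in> ?seg"
      using midpoint_in_closed_segment[of "- zb" zb] by (simp add: midpoint_def)
    then have "infdist (v k x) ?seg < \<rho>" for x
    proof (cases "(1/r) *\<^sub>R (x - a) \<in> ?B")
      case True
      then show ?thesis unfolding v_def by (rule near)
    next
      case False
      then show ?thesis using \<open>0 \<in> ?seg\<close> \<rho> supp[OF False] by (simp add: v_def)
    qed
    moreover have "(\<lambda>x. (norm (w k x))\<^sup>2) \<in> borel_measurable borel" by measurable
    from integral_lebesgue_affine[OF this r, of a]
    have "(\<integral>x. (norm (v k x))\<^sup>2 \<partial>lebesgue) = r ^ CARD('d) * (\<integral>x. (norm (w k x))\<^sup>2 \<partial>lebesgue)"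
      by (simp only: v_def DIM_cart DIM_real mult_1_right real_scaleR_def)
    then have "C * r ^ CARD('d) * (norm zb)\<^sup>2 \<le> (\<integral>x. (norm (v k x))\<^sup>2 \<partial>lebesgue)"
      using mult_left_mono[OF less_imp_le[OF spec[OF energy, of k]], of "r ^ CARD('d)"] r by (simp add: mult_ac)
    ultimately show "\<exists>v. oscillation A (ball a r) v \<and> (\<forall>x. infdist (v x) ?seg < \<rho>) \<and>
          (\<forall>g\<in>G. \<bar>\<integral>x. v x \<bullet> g x \<partial>lebesgue\<bar> < \<epsilon>) \<and>
          C * r ^ CARD('d) * (norm zb)\<^sup>2 \<le> (\<integral>x. (norm (v x))\<^sup>2 \<partial>lebesgue)"
      using osc[of k] small by blast
  qed
qed


lemma oscillation_add:
  assumes "oscillation A S v" "oscillation A S w" "bounded S"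
  shows "oscillation A S (\<lambda>x. v x + w x)"
  using oscillation_sum[of UNIV A S "\<lambda>b. if b then v else w"] assms by (simp add: UNIV_bool add.commute)

lemma integrable_inner_continuous_bounded:
  fixes f g :: "'a::euclidean_space \<Rightarrow> 'b::euclidean_space"
  assumes f: "continuous_on S f" "bounded (f ` S)" and g: "continuous_on S g" "bounded (g ` S)"
    and S: "S \<in> lmeasurable"
  shows "integrable (lebesgue_on S) (\<lambda>x. f x \<bullet> g x)"
proof (rule integrable_continuous_bounded[OF _ _ S])
  show "continuous_on S (\<lambda>x. f x \<bullet> g x)" using f g by (intro continuous_intros)
  obtain p where p: "\<forall>y\<in>f ` S. norm y \<le> p" using f(2) unfolding bounded_iff by (elim exE)
  obtain q where q: "\<forall>y\<in>g ` S. norm y \<le> q" using g(2) unfolding bounded_iff by (elim exE)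
  have "norm (f x \<bullet> g x) \<le> p * q" if "x \<in> S" for x
  proof -
    have "norm (f x) \<le> p" "norm (g x) \<le> q" using p q that by auto
    then have "norm (f x) * norm (g x) \<le> p * q" by (intro mult_mono) (auto intro: order_trans[OF norm_ge_zero])
    with Cauchy_Schwarz_ineq2[of "f x" "g x"] show ?thesis by simp
  qed
  then show "bounded ((\<lambda>x. f x \<bullet> g x) ` S)" unfolding bounded_iff by blast
qed

section \<open>The perturbation step\<close>

text \<open>The Hausdorff hypotheses are stored in pointwise form. The common radius
  \<open>R\<close> bounds all strict maps; it later bounds the energies of the iterates and provides
  the majorants for dominated convergence.\<close>

locale convex_integration =
  fixes A :: "'d::finite \<Rightarrow> real^'n::finite^'m::finite"
    and \<U> :: "(real^'d) set"
    and K :: "real^'d \<Rightarrow> (real^'n) set"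
    and \<Lambda> :: "(real^'n) set" and R :: real
  assumes open_U: "open \<U>" and bounded_U: "bounded \<U>"
    and K_compact: "y \<in> \<U> \<Longrightarrow> K y \<in> nonempty_compacts"
    and K_continuous: "\<lbrakk>y \<in> \<U>; 0 < e\<rbrakk> \<Longrightarrow> \<exists>\<delta>>0. \<forall>y'\<in>\<U>. dist y y' < \<delta> \<longrightarrow> hausdorff_dist (K y) (K y') < e"
    and K_bounded: "y \<in> \<U> \<Longrightarrow> K y \<subseteq> cball 0 R"
    and wave_cone: "wave_cone A \<Lambda>" and dense: "closure \<Lambda> = UNIV"
begin

definition strict :: "(real^'d \<Rightarrow> real^'n) set"
  where "strict = {z. continuous_on \<U> z \<and> (\<forall>y\<in>\<U>. z y \<in> interior (convex hull (K y)))}"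

definition defect :: "(real^'d \<Rightarrow> real^'n) \<Rightarrow> real^'d \<Rightarrow> real"
  where "defect z y = infdist (z y) (K y)"

lemma U_measurable: "\<U> \<in> lmeasurable"
  using bounded_U open_U by (rule lmeasurable_open)

lemma U_sets [measurable, simp]: "\<U> \<in> sets lebesgue"
  using U_measurable by (rule fmeasurableD)

lemma finite_measure_U: "finite_measure (lebesgue_on \<U>)"
  using U_measurable by (rule finite_measure_lebesgue_on)

lemma strict_norm_le: "z \<in> strict \<Longrightarrow> y \<in> \<U> \<Longrightarrow> norm (z y) \<le> R"
proof -
  assume "z \<in> strict" "y \<in> \<U>"
  then have "z y \<in> convex hull (K y)" using interior_subset by (auto simp: strict_def)
  moreover have "convex hull (K y) \<subseteq> cball 0 R"
    using K_bounded[OF \<open>y \<in> \<U>\<close>] by (intro hull_minimal) auto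
  ultimately show ?thesis by auto
qed

lemma strict_continuous: "z \<in> strict \<Longrightarrow> continuous_on \<U> z"
  by (simp add: strict_def)

lemma strict_bounded: "z \<in> strict \<Longrightarrow> bounded (z ` \<U>)"
  using strict_norm_le by (auto simp: bounded_iff)

lemma defect_nonneg: "0 \<le> defect z y"
  by (simp add: defect_def infdist_nonneg)

lemma defect_le:
  assumes "norm (z y) \<le> R" "y \<in> \<U>"
  shows "defect z y \<le> 2 * R"
proof -
  obtain k where k: "k \<in> K y" using K_compact[OF \<open>y \<in> \<U>\<close>] by (auto simp: nonempty_compacts_def)
  then have "norm k \<le> R" using K_bounded[OF assms(2)] by auto
  with assms(1) have "dist (z y) k \<le> 2 * R" using norm_triangle_ineq4[of "z y" k] by (simp add: dist_norm)
  with infdist_le[OF k, of "z y"] show ?thesis by (simp add: defect_def)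
qed

text \<open>\<open>infdist\<close> is 1-Lipschitz in the point, and also in the set with respect to
  the Hausdorff distance.\<close>

lemma defect_continuous:
  assumes z: "continuous_on \<U> z"
  shows "continuous_on \<U> (defect z)"
  unfolding continuous_on_iff
proof (intro ballI allI impI)
  fix y e assume y: "y \<in> \<U>" and e: "(0::real) < e"
  obtain \<delta>1 where \<delta>1: "\<delta>1 > 0" "\<And>y'. y' \<in> \<U> \<Longrightarrow> dist y' y < \<delta>1 \<Longrightarrow> dist (z y') (z y) < e / 2"
    using z y e unfolding continuous_on_iff by (meson half_gt_zero)
  obtain \<delta>2 where \<delta>2: "\<delta>2 > 0" "\<And>y'. y' \<in> \<U> \<Longrightarrow> dist y y' < \<delta>2 \<Longrightarrow> hausdorff_dist (K y) (K y') < e / 2"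
    using K_continuous[OF y half_gt_zero[OF e]] by blast
  have "dist (defect z y') (defect z y) < e" if y': "y' \<in> \<U>" and d: "dist y' y < min \<delta>1 \<delta>2" for y'
  proof -
    have h: "hausdorff_dist (K y) (K y') < e / 2" using \<delta>2(2)[OF y'] d by (simp add: dist_commute)
    have zz: "dist (z y') (z y) < e / 2" using \<delta>1(2)[OF y'] d by simp
    have "defect z y' \<le> infdist (z y') (K y) + hausdorff_dist (K y) (K y')"
      unfolding defect_def by (rule infdist_hausdorff_triangle[OF K_compact[OF y] K_compact[OF y']])
    also have "infdist (z y') (K y) \<le> defect z y + dist (z y') (z y)"
      unfolding defect_def by (rule infdist_triangle)
    finally have 1: "defect z y' - defect z y < e" using h zz by simp
    have "defect z y \<le> infdist (z y) (K y') + hausdorff_dist (K y') (K y)"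
      unfolding defect_def by (rule infdist_hausdorff_triangle[OF K_compact[OF y'] K_compact[OF y]])
    also have "infdist (z y) (K y') \<le> defect z y' + dist (z y) (z y')"
      unfolding defect_def by (rule infdist_triangle)
    finally have "defect z y - defect z y' < e"
      using h zz by (simp add: dist_commute hausdorff.commute)
    with 1 show ?thesis by (simp add: dist_real_def abs_if)
  qed
  then show "\<exists>d>0. \<forall>y'\<in>\<U>. dist y' y < d \<longrightarrow> dist (defect z y') (defect z y) < e"
    using \<delta>1(1) \<delta>2(1) by (intro exI[of _ "min \<delta>1 \<delta>2"]) auto
qed

text \<open>By compactness the segment has an e-neighbourhood inside the hull at \<open>y0\<close>.
  A quarter of e is spent on the variation of \<open>z\<close> and a quarter on the distance of
  \<open>v\<close> from the segment, which leaves a ball of radius e/2 about z y + v inside the old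
  hull. \<open>interior_convex_hull_close\<close> then absorbs the change of \<open>K\<close>, which
  is less than e/4.\<close>

lemma segment_stable:
  assumes z: "z \<in> strict" and y0: "y0 \<in> \<U>"
    and ends: "z y0 + zb \<in> interior (convex hull (K y0))" "z y0 - zb \<in> interior (convex hull (K y0))"
  obtains \<rho> r where "\<rho> > 0" "r > 0" "ball y0 r \<subseteq> \<U>"
    "\<And>y v. \<lbrakk>y \<in> ball y0 r; infdist v (closed_segment (- zb) zb) < \<rho>\<rbrakk> \<Longrightarrow> z y + v \<in> interior (convex hull (K y))"
proof -
  let ?C = "convex hull (K y0)"
  let ?T = "closed_segment (z y0 - zb) (z y0 + zb)"
  have "?T \<subseteq> interior ?C"
    using ends by (intro closed_segment_subset convex_interior convex_convex_hull) auto
  then obtain e where e: "e > 0" "(\<Union>x\<in>?T. cball x e) \<subseteq> interior ?C"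
    by (rule compact_subset_open_imp_cball_epsilon_subset[OF compact_segment open_interior])
  have e4: "e / 4 > 0" using e(1) by simp
  obtain \<delta>1 where \<delta>1: "\<delta>1 > 0" "\<And>y'. y' \<in> \<U> \<Longrightarrow> dist y' y0 < \<delta>1 \<Longrightarrow> dist (z y') (z y0) < e / 4"
    using strict_continuous[OF z] y0 e4 unfolding continuous_on_iff by meson
  obtain \<delta>2 where \<delta>2: "\<delta>2 > 0" "\<And>y'. y' \<in> \<U> \<Longrightarrow> dist y0 y' < \<delta>2 \<Longrightarrow> hausdorff_dist (K y0) (K y') < e / 4"
    using K_continuous[OF y0 e4] by blast
  obtain \<delta>3 where \<delta>3: "\<delta>3 > 0" "ball y0 \<delta>3 \<subseteq> \<U>" using open_U y0 open_contains_ball by blast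
  define r where "r = min \<delta>1 (min \<delta>2 \<delta>3)"
  have sub: "ball y0 r \<subseteq> \<U>" using \<delta>3(2) by (auto simp: r_def)
  show ?thesis
  proof (rule that[OF e4 _ sub])
    show "r > 0" using \<delta>1 \<delta>2 \<delta>3 by (simp add: r_def)
    fix y v assume y: "y \<in> ball y0 r" and v: "infdist v (closed_segment (- zb) zb) < e / 4"
    have yU: "y \<in> \<U>" using y sub by blast
    obtain s where s: "s \<in> closed_segment (- zb) zb" "infdist v (closed_segment (- zb) zb) = dist v s"
      by (rule infdist_attains_inf[of "closed_segment (- zb) zb" v]) auto
    have zs: "z y0 + s \<in> ?T"
      using s(1) closed_segment_translation_eq[of "z y0" s "- zb" zb] by simp
    have "dist (z y + v) (z y0 + s) \<le> dist (z y) (z y0) + dist v s" by (rule dist_triangle_add)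
    also have "\<dots> < e / 4 + e / 4"
      using \<delta>1(2)[OF yU] y v s(2) by (intro add_strict_mono) (auto simp: r_def dist_commute)
    finally have "dist (z y0 + s) (z y + v) < e / 2" by (simp add: dist_commute)
    then have "cball (z y + v) (e / 2) \<subseteq> cball (z y0 + s) e"
      by (smt (verit) dist_triangle mem_cball subsetI field_sum_of_halves)
    also have "\<dots> \<subseteq> ?C" using e(2) zs interior_subset by blast
    finally have "cball (z y + v) (e / 2) \<subseteq> ?C" .
    moreover have "hausdorff_dist (K y0) (K y) < e / 2"
      using \<delta>2(2)[OF yU] y e(1) by (auto simp: r_def)
    ultimately show "z y + v \<in> interior (convex hull (K y))"
      by (rule interior_convex_hull_close[OF K_compact[OF y0] K_compact[OF yU]])
  qed
qed

section \<open>Covering the set of positive defect by balls that admit one wave direction\<close>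

text \<open>The factor 8 is twice the factor 4 of \<open>dense_direction_in_convex_hull\<close>:
  over the ball the defect may grow to twice its value at the centre.\<close>

definition good_ball :: "(real^'d \<Rightarrow> real^'n) \<Rightarrow> real^'d \<Rightarrow> real \<Rightarrow> real \<Rightarrow> real^'n \<Rightarrow> bool"
  where "good_ball z a r \<rho> zb \<longleftrightarrow> r > 0 \<and> \<rho> > 0 \<and> zb \<in> \<Lambda> \<and> ball a r \<subseteq> \<U> \<and>
    (\<forall>y\<in>ball a r. defect z y \<le> 8 * (CARD('n) + 1) * norm zb \<and>
       (\<forall>v. infdist v (closed_segment (- zb) zb) < \<rho> \<longrightarrow> z y + v \<in> interior (convex hull (K y))))"

lemma good_ball_shrink: "good_ball z a r \<rho> zb \<Longrightarrow> 0 < r' \<Longrightarrow> r' \<le> r \<Longrightarrow> good_ball z a r' \<rho> zb"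
  using subset_ball[of r' r a] unfolding good_ball_def by blast

lemma good_ball_exists:
  assumes z: "z \<in> strict" and a: "a \<in> \<U>" and pos: "defect z a > 0"
  obtains r \<rho> zb where "good_ball z a r \<rho> zb"
proof -
  obtain zb where zb: "zb \<in> \<Lambda>" "z a + zb \<in> interior (convex hull (K a))"
      "z a - zb \<in> interior (convex hull (K a))" "infdist (z a) (K a) \<le> 4 * (DIM(real^'n) + 1) * norm zb"
    using dense_direction_in_convex_hull[OF _ dense, of "z a" "K a"] z a unfolding strict_def by blast
  obtain \<rho> r where \<rho>: "\<rho> > 0" "r > 0" "ball a r \<subseteq> \<U>"
    "\<And>y v. \<lbrakk>y \<in> ball a r; infdist v (closed_segment (- zb) zb) < \<rho>\<rbrakk> \<Longrightarrow> z y + v \<in> interior (convex hull (K y))"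
    using segment_stable[OF z a zb(2,3)] by blast
  \<comment> \<open>The permitted variation is the defect at the centre itself, which explains why
    only points of positive defect become centres.\<close>
  obtain \<delta> where \<delta>: "\<delta> > 0" "\<And>y. y \<in> \<U> \<Longrightarrow> dist y a < \<delta> \<Longrightarrow> dist (defect z y) (defect z a) < defect z a"
    using defect_continuous[OF strict_continuous[OF z]] a pos unfolding continuous_on_iff by meson
  have "defect z y \<le> 8 * (CARD('n) + 1) * norm zb" if y: "y \<in> ball a (min r \<delta>)" for y
  proof -
    have "dist (defect z y) (defect z a) < defect z a"
      using \<delta>(2)[of y] y \<rho>(3) by (auto simp: dist_commute)
    then have "defect z y \<le> 2 * defect z a" by (simp add: dist_real_def)
    also have "\<dots> \<le> 2 * (4 * (CARD('n) + 1) * norm zb)" using zb(4) by (simp add: defect_def)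
    finally show ?thesis by (simp add: algebra_simps)
  qed
  then have "good_ball z a (min r \<delta>) \<rho> zb"
    using \<rho> \<delta>(1) zb(1) by (auto simp: good_ball_def)
  then show ?thesis by (rule that)
qed

definition total_defect :: "(real^'d \<Rightarrow> real^'n) \<Rightarrow> real"
  where "total_defect z = (\<integral>y. (defect z y)\<^sup>2 \<partial>lebesgue_on \<U>)"

lemma defect_integrable:
  assumes z: "z \<in> strict"
  shows "integrable (lebesgue_on \<U>) (\<lambda>y. (defect z y)\<^sup>2)"
proof (rule integrable_continuous_bounded[OF _ _ U_measurable])
  show "continuous_on \<U> (\<lambda>y. (defect z y)\<^sup>2)"
    by (intro continuous_intros defect_continuous strict_continuous z)
  have "norm ((defect z y)\<^sup>2) \<le> (2 * R)\<^sup>2" if "y \<in> \<U>" for y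
    using power_mono[OF defect_le[of z, OF strict_norm_le[OF z that] that] defect_nonneg, of 2] by simp
  then show "bounded ((\<lambda>y. (defect z y)\<^sup>2) ` \<U>)" unfolding bounded_iff by blast
qed

text \<open>Vitali's theorem exhausts the set of positive defect up to a null set by countably many
  disjoint good balls. Giving up half of the total defect reduces them to finitely many, so that
  later the waves can be added without any question of convergence. On each ball the squared defect
  is at most the constant that multiplies its measure in the sum.\<close>

lemma finite_good_balls:
  assumes z: "z \<in> strict" and pos: "total_defect z > 0"
  shows "\<exists>J \<rho> zb. finite J \<and> (\<forall>(a, r)\<in>J. good_ball z a r (\<rho> a) (zb a)) \<and>
    pairwise (\<lambda>i j. disjnt (ball (fst i) (snd i)) (ball (fst j) (snd j))) J \<and>
    total_defect z / 2 \<le> (\<Sum>(a, r)\<in>J. (8 * (CARD('n) + 1) * norm (zb a))\<^sup>2 * measure lebesgue (ball a r))"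
proof -
  let ?M = "lebesgue_on \<U>"
  let ?f = "\<lambda>y. (defect z y)\<^sup>2"
  let ?B = "\<lambda>j::(real^'d) \<times> real. ball (fst j) (snd j)"
  define S where "S = {y \<in> \<U>. defect z y > 0}"
  have "\<forall>a\<in>S. \<exists>r \<rho> zb. good_ball z a r \<rho> zb"
    using good_ball_exists[OF z] by (auto simp: S_def) metis
  then obtain r0 \<rho> zb where good: "\<And>a. a \<in> S \<Longrightarrow> good_ball z a (r0 a) (\<rho> a) (zb a)" by metis
  \<comment> \<open>Vitali's theorem asks for arbitrarily small balls about every point. Shrinking a
    good ball preserves its tolerance and direction, so these can depend on the centre
    alone.\<close>
  define I where "I = {j. fst j \<in> S \<and> 0 < snd j \<and> snd j \<le> r0 (fst j)}"
  have good_I: "good_ball z (fst j) (snd j) (\<rho> (fst j)) (zb (fst j))" if "j \<in> I" for j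
    using that good_ball_shrink[OF good] by (auto simp: I_def)
  obtain C where C: "countable C" "C \<subseteq> I" "pairwise (\<lambda>i j. disjnt (?B i) (?B j)) C"
      "negligible (S - (\<Union>j\<in>C. ?B j))"
  proof (rule Vitali_covering_theorem_balls[of S I fst snd])
    fix x and d :: real assume x: "x \<in> S" and d: "0 < d"
    have "r0 x > 0" using good[OF x] by (simp add: good_ball_def)
    then show "\<exists>i. i \<in> I \<and> x \<in> ?B i \<and> snd i < d"
      using x d by (intro exI[of _ "(x, min (r0 x) (d / 2))"]) (auto simp: I_def)
  qed
  \<comment> \<open>Finite sets that increase to \<open>C\<close>; every ball of \<open>C\<close>
    belongs to all but finitely many of them, also when \<open>C\<close> is finite.\<close>
  define J where "J n = {j \<in> C. to_nat_on C j \<le> n}" for n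
  have fin: "finite (J n)" for n
  proof (rule finite_imageD)
    show "finite (to_nat_on C ` J n)" by (rule finite_subset[of _ "{..n}"]) (auto simp: J_def)
    show "inj_on (to_nat_on C) (J n)" using inj_on_to_nat_on[OF C(1)] by (rule inj_on_subset) (auto simp: J_def)
  qed
  define g where "g n y = indicator (\<Union>j\<in>J n. ?B j) y * ?f y" for n y
  have "(\<lambda>n. \<integral>y. g n y \<partial>?M) \<longlonglongrightarrow> (\<integral>y. ?f y \<partial>?M)"
  proof (rule integral_dominated_convergence[where w = ?f])
    show fM: "?f \<in> borel_measurable ?M" using defect_integrable[OF z] by (rule borel_measurable_integrable)
    show "integrable ?M ?f" by (rule defect_integrable[OF z])
    have "open (\<Union>j\<in>J n. ?B j)" for n by (intro open_UN) auto
    then have "(indicator (\<Union>j\<in>J n. ?B j) :: real^'d \<Rightarrow> real) \<in> borel_measurable ?M" for n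
      by (intro measurable_restrict_space1 borel_measurable_indicator) (simp add: sets_completionI_sets)
    then show "g n \<in> borel_measurable ?M" for n unfolding g_def using fM by (rule borel_measurable_times)
    show "AE y in ?M. norm (g n y) \<le> ?f y" for n by (auto simp: g_def indicator_def)
    have "AE y in lebesgue. y \<notin> S - (\<Union>j\<in>C. ?B j)"
      using C(4) unfolding negligible_iff_null_sets by (rule AE_not_in)
    then have "AE y in ?M. y \<notin> S - (\<Union>j\<in>C. ?B j)"
      by (simp add: AE_restrict_space_iff) (auto elim: AE_mp)
    moreover have "AE y in ?M. y \<in> \<U>" by (rule AE_I2) simp
    ultimately show "AE y in ?M. (\<lambda>n. g n y) \<longlonglongrightarrow> ?f y"
    proof eventually_elim
      case (elim y)
      show ?case
      proof (cases "y \<in> S")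
        case True
        then obtain j where j: "j \<in> C" "y \<in> ?B j" using elim by blast
        have "g n y = ?f y" if "n \<ge> to_nat_on C j" for n
          using j that by (auto simp: g_def J_def indicator_def)
        then show ?thesis by (intro tendsto_eventually eventually_sequentiallyI)
      next
        case False
        then have "defect z y = 0" using elim(2) defect_nonneg[of z y] by (auto simp: S_def)
        then show ?thesis by (simp add: g_def)
      qed
    qed
  qed
  then have "\<forall>\<^sub>F n in sequentially. (\<integral>y. g n y \<partial>?M) > total_defect z / 2"
    using pos by (intro order_tendstoD(1)[where y = "total_defect z"]) (simp_all add: total_defect_def)
  then obtain n where n: "(\<integral>y. g n y \<partial>?M) > total_defect z / 2"
    using eventually_happens'[OF sequentially_bot] by blast
  let ?c = "\<lambda>a. (8 * (CARD('n) + 1) * norm (zb a))\<^sup>2"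
  have JI: "J n \<subseteq> I" using C(2) by (auto simp: J_def)
  have sub: "?B j \<subseteq> \<U>" if "j \<in> J n" for j
    using good_I[of j] JI that by (auto simp: good_ball_def)
  have meas: "?B j \<in> sets ?M" if "j \<in> J n" for j
    using sub[OF that] by (simp add: sets_restrict_space_iff)
  have int: "integrable ?M (\<lambda>y. ?c (fst j) * indicator (?B j) y)" if "j \<in> J n" for j
    using finite_measure.emeasure_finite[OF finite_measure_U, of "?B j"]
    by (intro integrable_mult_right integrable_real_indicator meas that) (simp add: less_top)
  have "(\<integral>y. g n y \<partial>?M) \<le> (\<integral>y. (\<Sum>j\<in>J n. ?c (fst j) * indicator (?B j) y) \<partial>?M)"
  proof (rule integral_mono')
    show "integrable ?M (\<lambda>y. (\<Sum>j\<in>J n. ?c (fst j) * indicator (?B j) y))"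
      using int by (rule Bochner_Integration.integrable_sum)
    fix y assume "y \<in> space ?M"
    show "0 \<le> (\<Sum>j\<in>J n. ?c (fst j) * indicator (?B j) y)" by (intro sum_nonneg) auto
    show "g n y \<le> (\<Sum>j\<in>J n. ?c (fst j) * indicator (?B j) y)"
    proof (cases "y \<in> (\<Union>j\<in>J n. ?B j)")
      case True
      then obtain j where j: "j \<in> J n" "y \<in> ?B j" by blast
      have "defect z y \<le> 8 * (CARD('n) + 1) * norm (zb (fst j))"
        using good_I[of j] j JI by (auto simp: good_ball_def)
      then have "g n y \<le> ?c (fst j) * indicator (?B j) y"
        using True j defect_nonneg[of z y] by (simp add: g_def power_mono)
      also have "\<dots> \<le> (\<Sum>j\<in>J n. ?c (fst j) * indicator (?B j) y)"
        using j(1) fin by (intro member_le_sum) auto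
      finally show ?thesis .
    next
      case False
      then have "g n y = 0" by (simp add: g_def)
      then show ?thesis by (simp add: sum_nonneg)
    qed
  qed
  also have "\<dots> = (\<Sum>j\<in>J n. \<integral>y. ?c (fst j) * indicator (?B j) y \<partial>?M)"
    by (rule Bochner_Integration.integral_sum[OF int])
  also have "\<dots> = (\<Sum>j\<in>J n. ?c (fst j) * measure ?M (?B j))"
  proof (rule sum.cong[OF refl])
    fix j assume "j \<in> J n"
    then show "(\<integral>y. ?c (fst j) * indicator (?B j) y \<partial>?M) = ?c (fst j) * measure ?M (?B j)"
      using sub by (simp add: Int_absorb2)
  qed
  also have "\<dots> = (\<Sum>(a, r)\<in>J n. ?c a * measure lebesgue (ball a r))"
  proof (rule sum.cong[OF refl])
    fix j assume "j \<in> J n"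
    then show "?c (fst j) * measure ?M (?B j) = (case j of (a, r) \<Rightarrow> ?c a * measure lebesgue (ball a r))"
      using sub by (simp add: measure_restrict_space split_beta)
  qed
  finally have "total_defect z / 2 \<le> (\<Sum>(a, r)\<in>J n. ?c a * measure lebesgue (ball a r))" using n by simp
  moreover have "pairwise (\<lambda>i j. disjnt (?B i) (?B j)) (J n)"
    using C(3) by (rule pairwise_subset) (auto simp: J_def)
  moreover have "\<forall>(a, r)\<in>J n. good_ball z a r (\<rho> a) (zb a)" using good_I JI by force
  ultimately show ?thesis using fin[of n] by blast
qed

lemma oscillation_inner_integrable:
  assumes v: "oscillation A S v" and g: "continuous_on \<U> g" "bounded (g ` \<U>)" and S: "bounded S"
  shows "integrable (lebesgue_on \<U>) (\<lambda>x. v x \<bullet> g x)"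
proof (rule integrable_inner_continuous_bounded[OF _ _ g U_measurable])
  have v': "continuous_on UNIV v" "\<And>x. x \<notin> S \<Longrightarrow> v x = 0" using v by (auto simp: oscillation_def)
  then show "continuous_on \<U> v" by (auto intro: continuous_on_subset)
  have "bounded (range v)" by (rule continuous_bounded_support(2)[OF v'(1) _ S]) (rule v'(2))
  then show "bounded (v ` \<U>)" by (rule bounded_subset) auto
qed

text \<open>One wave is placed on each ball of the finite family. Disjoint supports let the energies
  add up and reduce strictness to one ball at a time. The number \<beta> is chosen before
  \<open>z\<close>, \<open>G\<close> and \<epsilon>, because the iteration applies the same \<beta>
  at every stage.\<close>

lemma perturbation:
  shows "\<exists>\<beta>>0. \<forall>z\<in>strict. \<forall>G \<epsilon>. finite G \<longrightarrow> (\<forall>g\<in>G. continuous_on \<U> g \<and> bounded (g ` \<U>)) \<longrightarrow> 0 < \<epsilon> \<longrightarrow>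
      (\<exists>v. oscillation A \<U> v \<and> (\<lambda>y. z y + v y) \<in> strict \<and>
          (\<forall>g\<in>G. \<bar>\<integral>x. v x \<bullet> g x \<partial>lebesgue_on \<U>\<bar> < \<epsilon>) \<and>
          \<beta> * total_defect z \<le> (\<integral>x. (norm (v x))\<^sup>2 \<partial>lebesgue_on \<U>))"
proof -
  obtain C where C: "C > 0" "\<forall>zb\<in>\<Lambda>. \<forall>a r \<rho> \<epsilon> G. 0 < r \<longrightarrow> 0 < \<rho> \<longrightarrow> 0 < \<epsilon> \<longrightarrow> finite G \<longrightarrow>
      (\<forall>g\<in>G. continuous_on (ball a r) g \<and> bounded (g ` ball a r)) \<longrightarrow>
      (\<exists>v. oscillation A (ball a r) v \<and> (\<forall>x. infdist (v x) (closed_segment (- zb) zb) < \<rho>) \<and>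
          (\<forall>g\<in>G. \<bar>\<integral>x. v x \<bullet> g x \<partial>lebesgue\<bar> < \<epsilon>) \<and>
          C * r ^ CARD('d) * (norm zb)\<^sup>2 \<le> (\<integral>x. (norm (v x))\<^sup>2 \<partial>lebesgue))"
    using wave_cone_localized[OF wave_cone] by (elim exE conjE)
  define \<omega> where "\<omega> = measure lebesgue (ball (0::real^'d) 1)"
  define c where "c = (8 * (real CARD('n) + 1))\<^sup>2"
  have \<omega>: "\<omega> > 0" unfolding \<omega>_def by (simp add: content_ball_pos)
  have c: "c > 0" by (simp add: c_def)
  \<comment> \<open>On a ball of radius r the squared defect contributes at most c |zb|^2 \<omega>
    r^D and the wave has energy at least C |zb|^2 r^D, so the ratio C / (c \<omega>) is free of r
    and |zb|. The 2 pays for the half lost in passing to finitely many balls.\<close>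
  show ?thesis
  proof (intro exI[of _ "C / (2 * c * \<omega>)"] conjI ballI allI impI)
    show "C / (2 * c * \<omega>) > 0" using C(1) \<omega> c by simp
    fix z and G :: "(real^'d \<Rightarrow> real^'n) set" and \<epsilon> :: real
    assume z: "z \<in> strict" and finG: "finite G" and \<epsilon>: "0 < \<epsilon>"
      and "\<forall>g\<in>G. continuous_on \<U> g \<and> bounded (g ` \<U>)"
    then have G: "\<And>g. g \<in> G \<Longrightarrow> continuous_on \<U> g \<and> bounded (g ` \<U>)" by blast
    show "\<exists>v. oscillation A \<U> v \<and> (\<lambda>y. z y + v y) \<in> strict \<and>
          (\<forall>g\<in>G. \<bar>\<integral>x. v x \<bullet> g x \<partial>lebesgue_on \<U>\<bar> < \<epsilon>) \<and>
          C / (2 * c * \<omega>) * total_defect z \<le> (\<integral>x. (norm (v x))\<^sup>2 \<partial>lebesgue_on \<U>)"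
    proof (cases "total_defect z = 0")
      case True
      have "oscillation A \<U> (\<lambda>x. 0)" by (simp add: oscillation_def)
      then show ?thesis using True z \<epsilon> by (intro exI[of _ "\<lambda>x. 0"]) simp
    next
      case False
      then have "total_defect z > 0" unfolding total_defect_def by (simp add: less_le integral_nonneg)
      from finite_good_balls[OF z this] obtain J \<rho> zb where J: "finite J"
        and "\<forall>(a, r)\<in>J. good_ball z a r (\<rho> a) (zb a)"
        and disj: "pairwise (\<lambda>i j. disjnt (ball (fst i) (snd i)) (ball (fst j) (snd j))) J"
        and big: "total_defect z / 2 \<le> (\<Sum>(a, r)\<in>J. (8 * (CARD('n) + 1) * norm (zb a))\<^sup>2 * measure lebesgue (ball a r))"
        by (elim exE conjE)
      then have good: "\<And>a r. (a, r) \<in> J \<Longrightarrow> good_ball z a r (\<rho> a) (zb a)" by auto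
      let ?B = "\<lambda>j::(real^'d) \<times> real. ball (fst j) (snd j)"
      \<comment> \<open>\<open>card J\<close> errors of this size stay strictly below \<epsilon>,
        even if \<open>J\<close> is empty.\<close>
      define e where "e = \<epsilon> / (card J + 1)"
      have e: "e > 0" using \<epsilon> by (simp add: e_def)
      have goodJ: "snd j > 0" "\<rho> (fst j) > 0" "zb (fst j) \<in> \<Lambda>" "?B j \<subseteq> \<U>"
        and goodJv: "\<And>y v. y \<in> ?B j \<Longrightarrow> infdist v (closed_segment (- zb (fst j)) (zb (fst j))) < \<rho> (fst j) \<Longrightarrow>
             z y + v \<in> interior (convex hull (K y))" if "j \<in> J" for j
        using good[of "fst j" "snd j"] that unfolding good_ball_def by auto
      have "\<forall>j\<in>J. \<exists>v. oscillation A (?B j) v \<and> (\<forall>x. infdist (v x) (closed_segment (- zb (fst j)) (zb (fst j))) < \<rho> (fst j)) \<and>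
          (\<forall>g\<in>G. \<bar>\<integral>x. v x \<bullet> g x \<partial>lebesgue\<bar> < e) \<and>
          C * snd j ^ CARD('d) * (norm (zb (fst j)))\<^sup>2 \<le> (\<integral>x. (norm (v x))\<^sup>2 \<partial>lebesgue)"
      proof
        fix j assume j: "j \<in> J"
        show "\<exists>v. oscillation A (?B j) v \<and> (\<forall>x. infdist (v x) (closed_segment (- zb (fst j)) (zb (fst j))) < \<rho> (fst j)) \<and>
          (\<forall>g\<in>G. \<bar>\<integral>x. v x \<bullet> g x \<partial>lebesgue\<bar> < e) \<and>
          C * snd j ^ CARD('d) * (norm (zb (fst j)))\<^sup>2 \<le> (\<integral>x. (norm (v x))\<^sup>2 \<partial>lebesgue)"
        proof (intro C(2)[rule_format, OF goodJ(3)[OF j] goodJ(1)[OF j] goodJ(2)[OF j] e finG])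
          fix g assume "g \<in> G"
          from G[OF this] show "continuous_on (?B j) g \<and> bounded (g ` ?B j)"
            using goodJ(4)[OF j] continuous_on_subset bounded_subset image_mono by metis
        qed
      qed
      from bchoice[OF this] obtain v where
        "\<forall>j\<in>J. oscillation A (?B j) (v j) \<and> (\<forall>x. infdist (v j x) (closed_segment (- zb (fst j)) (zb (fst j))) < \<rho> (fst j)) \<and>
          (\<forall>g\<in>G. \<bar>\<integral>x. v j x \<bullet> g x \<partial>lebesgue\<bar> < e) \<and>
          C * snd j ^ CARD('d) * (norm (zb (fst j)))\<^sup>2 \<le> (\<integral>x. (norm (v j x))\<^sup>2 \<partial>lebesgue)" by (elim exE)
      then have osc: "oscillation A (?B j) (v j)"
        and close: "infdist (v j x) (closed_segment (- zb (fst j)) (zb (fst j))) < \<rho> (fst j)"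
        and small: "g \<in> G \<Longrightarrow> \<bar>\<integral>x. v j x \<bullet> g x \<partial>lebesgue\<bar> < e"
        and energy: "C * snd j ^ CARD('d) * (norm (zb (fst j)))\<^sup>2 \<le> (\<integral>x. (norm (v j x))\<^sup>2 \<partial>lebesgue)"
        if "j \<in> J" for j x g using that by simp_all
      have supp: "v j x = 0" if "j \<in> J" "x \<notin> ?B j" for j x
        using osc[OF that(1)] that(2) by (simp add: oscillation_def)
      have contv: "continuous_on UNIV (v j)" if "j \<in> J" for j
        using osc[OF that] by (simp add: oscillation_def)
      define w where "w x = (\<Sum>j\<in>J. v j x)" for x
      \<comment> \<open>At most one wave is nonzero at a given point. The general \<open>f\<close>
        allows the identity, for the values of \<open>w\<close>, as well as the squared norm, for
        its energy.\<close>
      have single: "(\<Sum>i\<in>J. f (v i x)) = f (v j x)"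
        if "j \<in> J" "x \<in> ?B j" "f 0 = 0" for f :: "real^'n \<Rightarrow> 'z::comm_monoid_add" and j x
      proof -
        have "(\<Sum>i\<in>J. f (v i x)) = (\<Sum>i\<in>{j}. f (v i x))"
        proof (rule sum.mono_neutral_right[OF J])
          show "\<forall>i\<in>J - {j}. f (v i x) = 0"
          proof
            fix i assume i: "i \<in> J - {j}"
            then have "disjnt (?B i) (?B j)" using disj that(1) by (auto simp: pairwise_def)
            then have "x \<notin> ?B i" using that(2) by (auto simp: disjnt_def)
            then show "f (v i x) = 0" using supp[of i x] i that(3) by simp
          qed
        qed (use that in auto)
        then show ?thesis by simp
      qed
      have w_zero: "(\<Sum>i\<in>J. f (v i x)) = 0"
        if "\<And>j. j \<in> J \<Longrightarrow> x \<notin> ?B j" "f 0 = 0" for f :: "real^'n \<Rightarrow> 'z::comm_monoid_add" and x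
        using supp that by (intro sum.neutral) auto
      have osc_w: "oscillation A \<U> w"
        unfolding w_def[abs_def] using osc goodJ(4)
        by (intro oscillation_sum bounded_U) (blast intro: oscillation_mono)
      have norm_w: "(norm (w x))\<^sup>2 = (\<Sum>j\<in>J. (norm (v j x))\<^sup>2)" for x
      proof (cases "\<exists>j\<in>J. x \<in> ?B j")
        case True
        then obtain j where j: "j \<in> J" "x \<in> ?B j" by blast
        show ?thesis
          using single[OF j, of "\<lambda>u. u"] single[OF j, of "\<lambda>u. (norm u)\<^sup>2"] by (simp add: w_def)
      next
        case False
        then show ?thesis
          using w_zero[of x "\<lambda>u. u"] w_zero[of x "\<lambda>u. (norm u)\<^sup>2"] by (simp add: w_def)
      qed
      have "(\<lambda>y. z y + w y) \<in> strict"
        unfolding strict_def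
      proof (intro CollectI conjI ballI)
        have "continuous_on UNIV w" using osc_w by (simp add: oscillation_def)
        then show "continuous_on \<U> (\<lambda>y. z y + w y)"
          by (intro continuous_on_add strict_continuous[OF z]) (auto intro: continuous_on_subset)
        fix y assume y: "y \<in> \<U>"
        show "z y + w y \<in> interior (convex hull (K y))"
        proof (cases "\<exists>j\<in>J. y \<in> ?B j")
          case True
          then obtain j where j: "j \<in> J" "y \<in> ?B j" by blast
          have "w y = v j y" using single[OF j, of "\<lambda>u. u"] by (simp add: w_def)
          then show ?thesis using goodJv[OF j close[OF j(1)]] by simp
        next
          case False
          then have "w y = 0" using w_zero[of y "\<lambda>u. u"] by (simp add: w_def)
          then show ?thesis using z y by (simp add: strict_def)
        qed
      qed
      moreover have "\<bar>\<integral>x. w x \<bullet> g x \<partial>lebesgue_on \<U>\<bar> < \<epsilon>" if g: "g \<in> G" for g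
      proof -
        have "(\<integral>x. w x \<bullet> g x \<partial>lebesgue_on \<U>) = (\<integral>x. (\<Sum>j\<in>J. v j x \<bullet> g x) \<partial>lebesgue_on \<U>)"
          by (simp add: w_def inner_sum_left)
        also have "\<dots> = (\<Sum>j\<in>J. \<integral>x. v j x \<bullet> g x \<partial>lebesgue_on \<U>)"
          using oscillation_inner_integrable[OF osc] G[OF g] by (intro Bochner_Integration.integral_sum) auto
        also have "\<dots> = (\<Sum>j\<in>J. \<integral>x. v j x \<bullet> g x \<partial>lebesgue)"
          using supp goodJ(4) by (intro sum.cong[OF refl] integral_restrict_support U_sets) (metis inner_zero_left subsetD)
        finally have "\<bar>\<integral>x. w x \<bullet> g x \<partial>lebesgue_on \<U>\<bar> \<le> (\<Sum>j\<in>J. \<bar>\<integral>x. v j x \<bullet> g x \<partial>lebesgue\<bar>)"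
          by (simp add: sum_abs)
        also have "\<dots> \<le> (\<Sum>j\<in>J. e)" using small g by (intro sum_mono less_imp_le) auto
        also have "\<dots> < \<epsilon>" using \<epsilon> by (simp add: e_def field_simps)
        finally show ?thesis .
      qed
      moreover have "C / (2 * c * \<omega>) * total_defect z \<le> (\<integral>x. (norm (w x))\<^sup>2 \<partial>lebesgue_on \<U>)"
      proof -
        have "(\<integral>x. (norm (w x))\<^sup>2 \<partial>lebesgue_on \<U>) = (\<integral>x. (norm (w x))\<^sup>2 \<partial>lebesgue)"
          using osc_w by (intro integral_restrict_support U_sets) (simp add: oscillation_def)
        also have "\<dots> = (\<integral>x. (\<Sum>j\<in>J. (norm (v j x))\<^sup>2) \<partial>lebesgue)" by (simp add: norm_w)
        also have "\<dots> = (\<Sum>j\<in>J. \<integral>x. (norm (v j x))\<^sup>2 \<partial>lebesgue)"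
        proof (rule Bochner_Integration.integral_sum)
          fix j assume j: "j \<in> J"
          show "integrable lebesgue (\<lambda>x. (norm (v j x))\<^sup>2)"
          proof (rule continuous_bounded_support(1)[where S = "?B j"])
            show "continuous_on UNIV (\<lambda>x. (norm (v j x))\<^sup>2)"
              by (intro continuous_intros contv j)
          qed (use supp[OF j] in auto)
        qed
        finally have w_energy: "(\<integral>x. (norm (w x))\<^sup>2 \<partial>lebesgue_on \<U>) = (\<Sum>j\<in>J. \<integral>x. (norm (v j x))\<^sup>2 \<partial>lebesgue)" .
        have "(\<Sum>(a, r)\<in>J. (8 * (CARD('n) + 1) * norm (zb a))\<^sup>2 * measure lebesgue (ball a r))
            \<le> (\<Sum>j\<in>J. (c * \<omega> / C) * (\<integral>x. (norm (v j x))\<^sup>2 \<partial>lebesgue))"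
        proof (rule sum_mono)
          fix j assume j: "j \<in> J"
          have "measure lebesgue (?B j) = snd j ^ CARD('d) * \<omega>"
            using content_ball_conv_unit_ball[of "snd j" "fst j"] goodJ(1)[OF j] by (simp add: \<omega>_def)
          then have "(8 * (CARD('n) + 1) * norm (zb (fst j)))\<^sup>2 * measure lebesgue (?B j)
              = (c * \<omega> / C) * (C * snd j ^ CARD('d) * (norm (zb (fst j)))\<^sup>2)"
            using C(1) by (simp add: c_def power_mult_distrib)
          also have "\<dots> \<le> (c * \<omega> / C) * (\<integral>x. (norm (v j x))\<^sup>2 \<partial>lebesgue)"
            using energy[OF j] C(1) c \<omega> by (intro mult_left_mono) auto
          finally show "(case j of (a, r) \<Rightarrow> (8 * (CARD('n) + 1) * norm (zb a))\<^sup>2 * measure lebesgue (ball a r))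
              \<le> (c * \<omega> / C) * (\<integral>x. (norm (v j x))\<^sup>2 \<partial>lebesgue)" by (simp add: split_beta)
        qed
        with big have "total_defect z / 2 \<le> (c * \<omega> / C) * (\<integral>x. (norm (w x))\<^sup>2 \<partial>lebesgue_on \<U>)"
          by (simp add: w_energy sum_distrib_left)
        then show ?thesis using C(1) c \<omega> by (simp add: field_simps)
      qed
      ultimately show ?thesis using osc_w by blast
    qed
  qed
qed

end


section \<open>The iteration\<close>

lemma bounded_image_continuous:
  fixes f :: "'a::euclidean_space \<Rightarrow> 'b::metric_space"
  assumes "continuous_on UNIV f" "bounded S"
  shows "bounded (f ` S)"
proof -
  have "compact (f ` closure S)"
    using assms by (intro compact_continuous_image) (auto intro: continuous_on_subset simp: compact_closure)
  then show ?thesis using closure_subset[of S] by (meson bounded_subset compact_imp_bounded image_mono)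
qed

context convex_integration begin

lemma strict_square_expand:
  assumes u: "u \<in> strict" and v: "v \<in> strict"
  shows "(\<integral>y. (norm (v y))\<^sup>2 \<partial>lebesgue_on \<U>) = (\<integral>y. (norm (u y))\<^sup>2 \<partial>lebesgue_on \<U>)
    + 2 * (\<integral>y. (v y - u y) \<bullet> u y \<partial>lebesgue_on \<U>) + (\<integral>y. (norm (v y - u y))\<^sup>2 \<partial>lebesgue_on \<U>)"
proof -
  note c = strict_continuous[OF u] strict_continuous[OF v] strict_bounded[OF u] strict_bounded[OF v]
  have d: "continuous_on \<U> (\<lambda>y. v y - u y)" "bounded ((\<lambda>y. v y - u y) ` \<U>)"
    using c by (auto intro: continuous_on_diff bounded_minus_comp)
  have I: "integrable (lebesgue_on \<U>) (\<lambda>y. u y \<bullet> u y)" "integrable (lebesgue_on \<U>) (\<lambda>y. (v y - u y) \<bullet> u y)"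
      "integrable (lebesgue_on \<U>) (\<lambda>y. (v y - u y) \<bullet> (v y - u y))"
    using c d by (auto intro!: integrable_inner_continuous_bounded U_measurable)
  have I2: "integrable (lebesgue_on \<U>) (\<lambda>y. 2 * ((v y - u y) \<bullet> u y))"
    using I(2) by (rule integrable_mult_right)
  have "(\<integral>y. (norm (v y))\<^sup>2 \<partial>lebesgue_on \<U>)
      = (\<integral>y. u y \<bullet> u y + 2 * ((v y - u y) \<bullet> u y) + (v y - u y) \<bullet> (v y - u y) \<partial>lebesgue_on \<U>)"
    by (intro Bochner_Integration.integral_cong refl)
      (simp add: power2_norm_eq_inner inner_diff_left inner_diff_right inner_commute)
  also have "\<dots> = (\<integral>y. u y \<bullet> u y \<partial>lebesgue_on \<U>) + 2 * (\<integral>y. (v y - u y) \<bullet> u y \<partial>lebesgue_on \<U>)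
      + (\<integral>y. (v y - u y) \<bullet> (v y - u y) \<partial>lebesgue_on \<U>)"
    using Bochner_Integration.integral_add[OF Bochner_Integration.integrable_add[OF I(1) I2] I(3)]
      Bochner_Integration.integral_add[OF I(1) I2] by simp
  finally show ?thesis by (simp only: power2_norm_eq_inner)
qed

lemma strict_diff_integrable:
  assumes u: "u \<in> strict" and v: "v \<in> strict"
  shows "integrable (lebesgue_on \<U>) (\<lambda>y. (norm (v y - u y))\<^sup>2)" "integrable (lebesgue_on \<U>) (\<lambda>y. norm (v y - u y))"
proof -
  have c: "continuous_on \<U> (\<lambda>y. v y - u y)"
    using strict_continuous[OF u] strict_continuous[OF v] by (rule continuous_on_diff[rotated])
  have "norm (v y - u y) \<le> 2 * R" if "y \<in> \<U>" for y
    using norm_triangle_ineq4[of "v y" "u y"] strict_norm_le[OF u that] strict_norm_le[OF v that] by simp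
  then have b: "bounded ((\<lambda>y. v y - u y) ` \<U>)" unfolding bounded_iff by blast
  then show "integrable (lebesgue_on \<U>) (\<lambda>y. norm (v y - u y))"
    by (intro integrable_norm integrable_continuous_bounded c U_measurable)
  obtain p where "\<forall>x\<in>(\<lambda>y. v y - u y) ` \<U>. norm x \<le> p" using b unfolding bounded_iff by (elim exE)
  then have "bounded ((\<lambda>y. (norm (v y - u y))\<^sup>2) ` \<U>)"
    unfolding bounded_iff by (intro exI[of _ "p\<^sup>2"]) (auto intro: power_mono)
  then show "integrable (lebesgue_on \<U>) (\<lambda>y. (norm (v y - u y))\<^sup>2)"
    by (intro integrable_continuous_bounded U_measurable continuous_intros c)
qed

text \<open>Increments that are almost orthogonal to all earlier iterates make \<open>\<parallel>Z k\<parallel>\<^sup>2\<close> almost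
  monotone; being bounded, it converges, and by orthogonality \<open>\<parallel>Z m - Z k\<parallel>\<^sup>2\<close> is controlled by
  \<open>\<parallel>Z m\<parallel>\<^sup>2 - \<parallel>Z k\<parallel>\<^sup>2\<close>. This yields strong convergence without any Baire category argument.\<close>

lemma almost_orthogonal_Cauchy:
  assumes Z: "\<And>k. Z k \<in> strict" and \<epsilon>: "0 < \<epsilon>"
    and orth: "\<And>i j. i \<le> j \<Longrightarrow> \<bar>\<integral>y. (Z j y - Z i y) \<bullet> Z i y \<partial>lebesgue_on \<U>\<bar> \<le> \<epsilon> / 2 ^ i"
    and orth1: "\<And>i. \<bar>\<integral>y. (Z (Suc i) y - Z i y) \<bullet> Z i y \<partial>lebesgue_on \<U>\<bar> \<le> \<epsilon> / 2 ^ Suc i"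
    and \<delta>: "0 < \<delta>"
  shows "\<exists>n. \<forall>k\<ge>n. \<forall>m\<ge>k. (\<integral>y. (norm (Z m y - Z k y))\<^sup>2 \<partial>lebesgue_on \<U>) < \<delta>"
proof -
  define N where "N k = (\<integral>y. (norm (Z k y))\<^sup>2 \<partial>lebesgue_on \<U>)" for k
  \<comment> \<open>Step k can lower \<open>N\<close> by at most 2 \<epsilon> / 2^(k+1). The
    correction is the sum of these possible losses over all steps from k on, which makes
    \<open>P\<close> increasing.\<close>
  define P where "P k = N k - 2 * \<epsilon> / 2 ^ k" for k
  have expand: "N m = N k + 2 * (\<integral>y. (Z m y - Z k y) \<bullet> Z k y \<partial>lebesgue_on \<U>)
      + (\<integral>y. (norm (Z m y - Z k y))\<^sup>2 \<partial>lebesgue_on \<U>)" for k m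
    unfolding N_def by (rule strict_square_expand[OF Z Z])
  have "P k \<le> P (Suc k)" for k
  proof -
    have "0 \<le> (\<integral>y. (norm (Z (Suc k) y - Z k y))\<^sup>2 \<partial>lebesgue_on \<U>)" by simp
    then have "N k - 2 * (\<epsilon> / 2 ^ Suc k) \<le> N (Suc k)"
      using expand[of "Suc k" k] orth1[of k] by (smt (verit))
    moreover have "2 * \<epsilon> / 2 ^ k = 2 * (\<epsilon> / 2 ^ Suc k) + 2 * \<epsilon> / 2 ^ Suc k" by (simp add: field_simps)
    ultimately show ?thesis unfolding P_def by linarith
  qed
  then have "incseq P" by (rule incseq_SucI)
  moreover have "P k \<le> R\<^sup>2 * measure (lebesgue_on \<U>) \<U>" for k
  proof -
    interpret finite_measure "lebesgue_on \<U>" by (rule finite_measure_U)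
    have "N k \<le> (\<integral>y. R\<^sup>2 \<partial>lebesgue_on \<U>)" unfolding N_def
      using strict_norm_le[OF Z] by (intro integral_mono') (auto intro: power_mono)
    moreover have "0 \<le> 2 * \<epsilon> / 2 ^ k" using \<epsilon> by simp
    ultimately show ?thesis unfolding P_def by (simp add: mult.commute)
  qed
  ultimately obtain L where "P \<longlonglongrightarrow> L" by (metis incseq_convergent)
  then have "Cauchy P" by (rule LIMSEQ_imp_Cauchy)
  then obtain n1 where n1: "\<And>k m. k \<ge> n1 \<Longrightarrow> m \<ge> n1 \<Longrightarrow> norm (P m - P k) < \<delta> / 2"
    using CauchyD[of P "\<delta> / 2"] \<delta> by (meson half_gt_zero)
  have "(\<lambda>k. 4 * \<epsilon> * (1 / 2) ^ k) \<longlonglongrightarrow> 0" by (intro tendsto_mult_right_zero LIMSEQ_power_zero) simp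
  then have "\<forall>\<^sub>F k in sequentially. 4 * \<epsilon> * (1 / 2) ^ k < \<delta> / 2"
    using \<delta> by (rule order_tendstoD(2)[OF _ half_gt_zero])
  then obtain n2 where n2: "\<And>k. k \<ge> n2 \<Longrightarrow> 4 * \<epsilon> / 2 ^ k < \<delta> / 2"
    unfolding eventually_sequentially by (auto simp: power_one_over)
  have "(\<integral>y. (norm (Z m y - Z k y))\<^sup>2 \<partial>lebesgue_on \<U>) < \<delta>" if k: "k \<ge> max n1 n2" and m: "m \<ge> k" for k m
  proof -
    have "\<epsilon> / 2 ^ m \<le> \<epsilon> / 2 ^ k" using m \<epsilon> by (intro divide_left_mono power_increasing) auto
    moreover have "P m - P k < \<delta> / 2" using n1[of k m] k m abs_ge_self[of "P m - P k"] by simp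
    moreover have "4 * \<epsilon> / 2 ^ k < \<delta> / 2" using n2 k by simp
    ultimately show ?thesis
      using expand[of m k] orth[OF m] unfolding P_def abs_le_iff by linarith
  qed
  then show ?thesis by blast
qed

lemma total_defect_nonneg: "0 \<le> total_defect z"
  by (simp add: total_defect_def)

text \<open>Each new iterate joins the set of tested functions, so every later increment is almost
  orthogonal to it, with tolerances that form a geometric series. Including \<open>g\<close> from
  the start keeps the whole sequence weakly close to \<open>z\<close> in this one direction, however
  far it moves in norm.\<close>

lemma iteration:
  assumes z: "z \<in> strict" and g: "continuous_on \<U> g" "bounded (g ` \<U>)" and \<epsilon>: "0 < \<epsilon>"
  shows "\<exists>Z. (\<forall>k. Z k \<in> strict) \<and> (\<forall>k. oscillation A \<U> (\<lambda>y. Z k y - z y)) \<and>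
    (\<forall>k. \<bar>\<integral>y. (Z k y - z y) \<bullet> g y \<partial>lebesgue_on \<U>\<bar> \<le> \<epsilon>) \<and>
    (\<lambda>k. total_defect (Z k)) \<longlonglongrightarrow> 0 \<and>
    (\<forall>\<delta>>0. \<exists>n. \<forall>k\<ge>n. \<forall>m\<ge>k. (\<integral>y. (norm (Z m y - Z k y))\<^sup>2 \<partial>lebesgue_on \<U>) < \<delta>)"
proof -
  let ?M = "lebesgue_on \<U>"
  obtain \<beta> where \<beta>: "\<beta> > 0" "\<forall>z\<in>strict. \<forall>G \<epsilon>. finite G \<longrightarrow> (\<forall>g\<in>G. continuous_on \<U> g \<and> bounded (g ` \<U>)) \<longrightarrow> 0 < \<epsilon> \<longrightarrow>
      (\<exists>v. oscillation A \<U> v \<and> (\<lambda>y. z y + v y) \<in> strict \<and>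
          (\<forall>g\<in>G. \<bar>\<integral>x. v x \<bullet> g x \<partial>?M\<bar> < \<epsilon>) \<and> \<beta> * total_defect z \<le> (\<integral>x. (norm (v x))\<^sup>2 \<partial>?M))"
    using perturbation by (elim exE conjE)
  \<comment> \<open>A state consists of the set of functions tested so far and the current iterate.
    The clause for n = 0 pins the starting point, because dependent choice would otherwise only
    provide some initial state.\<close>
  define P where "P n s \<longleftrightarrow> finite (fst s) \<and> g \<in> fst s \<and> snd s \<in> fst s \<and> snd s \<in> strict \<and>
      (\<forall>h\<in>fst s. continuous_on \<U> h \<and> bounded (h ` \<U>)) \<and> oscillation A \<U> (\<lambda>y. snd s y - z y) \<and>
      (n = 0 \<longrightarrow> snd s = z)" for n :: nat and s
  define Q where "Q n s t \<longleftrightarrow> fst t = insert (snd t) (fst s) \<and>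
      (\<forall>h\<in>fst s. \<bar>\<integral>y. (snd t y - snd s y) \<bullet> h y \<partial>?M\<bar> < \<epsilon> / 2 ^ Suc n) \<and>
      \<beta> * total_defect (snd s) \<le> (\<integral>y. (norm (snd t y - snd s y))\<^sup>2 \<partial>?M)" for n and s t :: "(real^'d \<Rightarrow> real^'n) set \<times> (real^'d \<Rightarrow> real^'n)"
  have "\<exists>f. \<forall>n. P n (f n) \<and> Q n (f n) (f (Suc n))"
  proof (rule dependent_nat_choice)
    have "P 0 ({g, z}, z)"
      using z g strict_continuous[OF z] strict_bounded[OF z] by (simp add: P_def oscillation_def)
    then show "\<exists>s. P 0 s" by blast
    fix s n assume P: "P n s"
    obtain G u where s: "s = (G, u)" by (cases s)
    have u: "u \<in> strict" "finite G" "\<forall>h\<in>G. continuous_on \<U> h \<and> bounded (h ` \<U>)" "g \<in> G"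
        "oscillation A \<U> (\<lambda>y. u y - z y)"
      using P by (auto simp: P_def s)
    have e: "0 < \<epsilon> / 2 ^ Suc n" using \<epsilon> by simp
    obtain v where v: "oscillation A \<U> v" "(\<lambda>y. u y + v y) \<in> strict"
          "\<forall>h\<in>G. \<bar>\<integral>x. v x \<bullet> h x \<partial>?M\<bar> < \<epsilon> / 2 ^ Suc n" "\<beta> * total_defect u \<le> (\<integral>x. (norm (v x))\<^sup>2 \<partial>?M)"
      using bspec[OF \<beta>(2) u(1), THEN spec, THEN spec, THEN mp, OF u(2), THEN mp, OF u(3), THEN mp, OF e]
      by (elim exE conjE)
    let ?t = "(insert (\<lambda>y. u y + v y) G, \<lambda>y. u y + v y)"
    have "oscillation A \<U> (\<lambda>y. u y + v y - z y)"
      using oscillation_add[OF u(5) v(1) bounded_U] by (simp add: algebra_simps)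
    then have "P (Suc n) ?t"
      using u v strict_continuous[OF v(2)] strict_bounded[OF v(2)] by (simp add: P_def)
    moreover have "Q n s ?t" using v by (simp add: Q_def s)
    ultimately show "\<exists>t. P (Suc n) t \<and> Q n s t" by blast
  qed
  then obtain f where "\<forall>n. P n (f n) \<and> Q n (f n) (f (Suc n))" by (elim exE)
  then have P: "P n (f n)" and Q: "Q n (f n) (f (Suc n))" for n by simp_all
  define Z where "Z n = snd (f n)" for n
  have Z: "Z k \<in> strict" "oscillation A \<U> (\<lambda>y. Z k y - z y)" for k
    using P[of k] by (auto simp: P_def Z_def)
  have Z0: "Z 0 = z" using P[of 0] by (simp add: P_def Z_def)
  have G_mono: "fst (f i) \<subseteq> fst (f j)" if "i \<le> j" for i j
    using lift_Suc_mono_le[of "\<lambda>n. fst (f n)", OF _ that] Q by (auto simp: Q_def)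
  have step: "\<bar>\<integral>y. (Z (Suc j) y - Z j y) \<bullet> h y \<partial>?M\<bar> < \<epsilon> / 2 ^ Suc j" if "h \<in> fst (f j)" for h j
    using Q[of j] that by (simp add: Q_def Z_def)
  \<comment> \<open>Stating the bound as a difference of geometric terms, rather than as \<epsilon>
    / 2^i, is what closes the induction on \<open>j\<close>.\<close>
  have tele: "\<bar>\<integral>y. (Z j y - Z i y) \<bullet> h y \<partial>?M\<bar> \<le> \<epsilon> / 2 ^ i - \<epsilon> / 2 ^ j" if h: "h \<in> fst (f i)" and "i \<le> j" for h i j
    using \<open>i \<le> j\<close>
  proof (induction j rule: dec_induct)
    case base
    then show ?case by simp
  next
    case (step j)
    have hj: "h \<in> fst (f j)" using h G_mono[OF step(1)] by blast
    have hc: "continuous_on \<U> h" "bounded (h ` \<U>)" using P[of i] h by (auto simp: P_def)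
    have I: "integrable ?M (\<lambda>y. (Z m y - z y) \<bullet> h y)" for m
      by (rule oscillation_inner_integrable[OF Z(2) hc bounded_U])
    have J: "(\<integral>y. (Z m y - Z l y) \<bullet> h y \<partial>?M) = (\<integral>y. (Z m y - z y) \<bullet> h y \<partial>?M) - (\<integral>y. (Z l y - z y) \<bullet> h y \<partial>?M)" for m l
      unfolding Bochner_Integration.integral_diff[OF I I, symmetric]
      by (simp add: inner_diff_left)
    have "\<bar>\<integral>y. (Z (Suc j) y - Z j y) \<bullet> h y \<partial>?M\<bar> < \<epsilon> / 2 ^ Suc j"
      using Q[of j] hj by (simp add: Q_def Z_def)
    moreover have "\<epsilon> / 2 ^ Suc j = \<epsilon> / 2 ^ j - \<epsilon> / 2 ^ Suc j" by (simp add: field_simps)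
    ultimately show ?case using step.IH unfolding J by linarith
  qed
  have Z_in: "Z i \<in> fst (f i)" for i using P[of i] by (simp add: P_def Z_def)
  have cauchy: "\<exists>n. \<forall>k\<ge>n. \<forall>m\<ge>k. (\<integral>y. (norm (Z m y - Z k y))\<^sup>2 \<partial>?M) < \<delta>" if "0 < \<delta>" for \<delta>
  proof (rule almost_orthogonal_Cauchy[OF Z(1) \<epsilon> _ _ that])
    fix i j :: nat assume "i \<le> j"
    moreover have "0 \<le> \<epsilon> / 2 ^ j" using \<epsilon> by simp
    ultimately show "\<bar>\<integral>y. (Z j y - Z i y) \<bullet> Z i y \<partial>?M\<bar> \<le> \<epsilon> / 2 ^ i" using tele[OF Z_in] by fastforce
  next
    fix i
    show "\<bar>\<integral>y. (Z (Suc i) y - Z i y) \<bullet> Z i y \<partial>?M\<bar> \<le> \<epsilon> / 2 ^ Suc i" using step[OF Z_in] by (rule less_imp_le)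
  qed
  show ?thesis
  proof (intro exI[of _ Z] conjI allI impI Z cauchy)
    fix k
    have "g \<in> fst (f 0)" using P[of 0] by (simp add: P_def)
    moreover have "0 \<le> \<epsilon> / 2 ^ k" using \<epsilon> by simp
    ultimately show "\<bar>\<integral>y. (Z k y - z y) \<bullet> g y \<partial>?M\<bar> \<le> \<epsilon>"
      using tele[of g 0 k] by (simp add: Z0)
  next
    \<comment> \<open>\<beta> times the defect of \<open>Z k\<close> is at most the energy of the
      next increment, which is small by the Cauchy property.\<close>
    show "(\<lambda>k. total_defect (Z k)) \<longlonglongrightarrow> 0"
    proof (rule LIMSEQ_I)
      fix r :: real assume r: "0 < r"
      then obtain n where n: "\<forall>k\<ge>n. \<forall>m\<ge>k. (\<integral>y. (norm (Z m y - Z k y))\<^sup>2 \<partial>?M) < \<beta> * r"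
        using cauchy[of "\<beta> * r"] \<beta>(1) by auto
      have "norm (total_defect (Z k) - 0) < r" if "k \<ge> n" for k
      proof -
        have "\<beta> * total_defect (Z k) \<le> (\<integral>y. (norm (Z (Suc k) y - Z k y))\<^sup>2 \<partial>?M)"
          using Q[of k] by (simp add: Q_def Z_def)
        also have "\<dots> < \<beta> * r" using n that by simp
        finally show ?thesis using \<beta>(1) total_defect_nonneg[of "Z k"] by simp
      qed
      then show "\<exists>n. \<forall>k\<ge>n. norm (total_defect (Z k) - 0) < r" by blast
    qed
  qed
qed

end


section \<open>Limits of the iteration\<close>

lemma hausdorff_continuousD:
  fixes K :: "'a::metric_space \<Rightarrow> 'b::metric_space set"
  assumes K: "continuous_map (top_of_set S) hausdorff.mtopology K" and y: "y \<in> S" and e: "0 < e"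
  shows "\<exists>\<delta>>0. \<forall>y'\<in>S. dist y y' < \<delta> \<longrightarrow> hausdorff_dist (K y) (K y') < e"
proof -
  have "\<exists>V. openin (top_of_set S) V \<and> y \<in> V \<and> (\<forall>y'\<in>V. K y' \<in> hausdorff.mball (K y) e)"
    using K y e unfolding hausdorff.continuous_map_to_metric by simp
  then obtain V where V: "openin (top_of_set S) V" "y \<in> V" "\<forall>y'\<in>V. K y' \<in> hausdorff.mball (K y) e"
    by (elim exE conjE)
  obtain \<delta> where "\<delta> > 0" "ball y \<delta> \<inter> S \<subseteq> V"
    using V(1,2) by (meson openin_contains_ball)
  then show ?thesis using V(3) by (intro exI[of _ \<delta>]) auto
qed

lemma hausdorff_mboundedD:
  fixes K :: "'a \<Rightarrow> 'b::real_normed_vector set"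
  assumes "hausdorff.mbounded (K ` S)"
  shows "\<exists>R. \<forall>y\<in>S. K y \<in> nonempty_compacts \<and> K y \<subseteq> cball 0 R"
proof -
  obtain L B where L: "K ` S \<subseteq> hausdorff.mcball L B" using assms unfolding hausdorff.mbounded_def by blast
  show ?thesis
  proof (cases "L \<in> nonempty_compacts")
    \<comment> \<open>A closed ball whose centre lies outside the carrier is empty, so there is no y
      to consider.\<close>
    case False
    then have "S = {}" using L by auto
    then show ?thesis by simp
  next
    case True
    then have "bounded L" "L \<noteq> {}" by (auto simp: nonempty_compacts_def compact_imp_bounded)
    then obtain b where b: "\<forall>x\<in>L. norm x \<le> b" unfolding bounded_iff by blast
    have "K y \<in> nonempty_compacts \<and> K y \<subseteq> cball 0 (b + B)" if "y \<in> S" for y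
    proof
      have y: "K y \<in> nonempty_compacts" "hausdorff_dist L (K y) \<le> B" using L that by auto
      show "K y \<in> nonempty_compacts" by (rule y(1))
      show "K y \<subseteq> cball 0 (b + B)"
      proof
        fix x assume "x \<in> K y"
        then have "infdist x L \<le> B"
          using infdist_le_hausdorff_dist[OF y(1) True] y(2) by (fastforce simp: hausdorff.commute)
        moreover have "norm x - b \<le> infdist x L"
        proof -
          have "norm x - b \<le> dist x l" if "l \<in> L" for l
            using bspec[OF b that] norm_triangle_ineq2[of x l] by (simp add: dist_norm)
          then show ?thesis using \<open>L \<noteq> {}\<close> by (auto simp: infdist_def intro: cINF_greatest)
        qed
        ultimately show "x \<in> cball 0 (b + B)" by simp
      qed
    qed
    then show ?thesis by blast
  qed
qed

context convex_integration begin

text \<open>Finite measure turns the Cauchy property in \<open>L2\<close> into one in L1, which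
  yields a subsequence converging almost everywhere; a further one makes the squared defects tend to
  zero almost everywhere. For fixed y the distance to \<open>K y\<close> is continuous in the value,
  so the limit has distance zero from a closed set.\<close>

lemma strict_subsequence_limit:
  assumes Z: "\<And>k. Z k \<in> strict"
    and cauchy: "\<forall>\<delta>>0. \<exists>n. \<forall>k\<ge>n. \<forall>m\<ge>k. (\<integral>y. (norm (Z m y - Z k y))\<^sup>2 \<partial>lebesgue_on \<U>) < \<delta>"
    and defect: "(\<lambda>k. total_defect (Z k)) \<longlonglongrightarrow> 0"
  shows "\<exists>r \<zeta>. \<zeta> \<in> borel_measurable (lebesgue_on \<U>) \<and>
    (AE y in lebesgue_on \<U>. (\<lambda>i. Z (r i) y) \<longlonglongrightarrow> \<zeta> y) \<and> (AE y in lebesgue_on \<U>. \<zeta> y \<in> K y)"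
proof -
  let ?M = "lebesgue_on \<U>"
  interpret finite_measure ?M by (rule finite_measure_U)
  have Z_int: "integrable ?M (Z k)" for k
    by (rule integrable_continuous_bounded[OF strict_continuous[OF Z] strict_bounded[OF Z] U_measurable])
  define \<mu> where "\<mu> = measure ?M \<U>"
  have \<mu>: "0 \<le> \<mu>" by (simp add: \<mu>_def)
  have "\<exists>n. \<forall>i\<ge>n. \<forall>j\<ge>n. (\<integral>y. norm (Z i y - Z j y) \<partial>?M) < e" if e: "0 < e" for e
  proof -
    \<comment> \<open>The weight is such that \<eta> times the measure of \<open>\<U>\<close> is at
      most e/2; adding 1 to \<mu> keeps the denominator positive.\<close>
    define \<eta> where "\<eta> = e / (2 * (\<mu> + 1))"
    have \<eta>: "0 < \<eta>" using e \<mu> by (simp add: \<eta>_def)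
    have \<eta>\<mu>: "\<eta> * \<mu> \<le> e / 2" using e \<mu> by (simp add: \<eta>_def field_simps)
    have "0 < \<eta> * (e / 2)" using \<eta> e by simp
    then obtain n where n: "\<forall>k\<ge>n. \<forall>m\<ge>k. (\<integral>y. (norm (Z m y - Z k y))\<^sup>2 \<partial>?M) < \<eta> * (e / 2)"
      using cauchy by blast
    have ordered: "(\<integral>y. norm (Z i y - Z j y) \<partial>?M) < e" if "n \<le> j" "j \<le> i" for i j
    proof -
      have "(\<integral>y. norm (Z i y - Z j y) \<partial>?M) \<le> (\<integral>y. \<eta> + (norm (Z i y - Z j y))\<^sup>2 / \<eta> \<partial>?M)"
      proof (rule integral_mono)
        show "integrable ?M (\<lambda>y. norm (Z i y - Z j y))" by (rule strict_diff_integrable(2)[OF Z Z])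
        show "integrable ?M (\<lambda>y. \<eta> + (norm (Z i y - Z j y))\<^sup>2 / \<eta>)"
          using strict_diff_integrable(1)[OF Z Z, of i j] by simp
        \<comment> \<open>This elementary inequality takes the place of the Cauchy-Schwarz
          inequality for integrals.\<close>
        have "t \<le> \<eta> + t\<^sup>2 / \<eta>" if "0 \<le> t" for t :: real
        proof (cases "t \<le> \<eta>")
          case True
          moreover have "0 \<le> t\<^sup>2 / \<eta>" using \<eta> by simp
          ultimately show ?thesis by linarith
        next
          case False
          then have "t * \<eta> \<le> t * t" using that by (intro mult_left_mono) auto
          then have "t \<le> t\<^sup>2 / \<eta>" using \<eta> by (simp add: field_simps power2_eq_square)
          then show ?thesis using \<eta> by linarith
        qed
        then show "norm (Z i y - Z j y) \<le> \<eta> + (norm (Z i y - Z j y))\<^sup>2 / \<eta>" for y by simp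
      qed
      also have "\<dots> = \<eta> * \<mu> + (\<integral>y. (norm (Z i y - Z j y))\<^sup>2 \<partial>?M) / \<eta>"
        using strict_diff_integrable(1)[OF Z Z, of i j] by (simp add: \<mu>_def)
      also have "\<dots> < e"
      proof -
        have "(\<integral>y. (norm (Z i y - Z j y))\<^sup>2 \<partial>?M) < \<eta> * (e / 2)" using n that by blast
        then have "(\<integral>y. (norm (Z i y - Z j y))\<^sup>2 \<partial>?M) / \<eta> < e / 2"
          using \<eta> by (simp add: pos_divide_less_eq mult.commute)
        then show ?thesis using \<eta>\<mu> by linarith
      qed
      finally show ?thesis .
    qed
    have "(\<integral>y. norm (Z i y - Z j y) \<partial>?M) < e" if "n \<le> i" "n \<le> j" for i j
      using ordered[of i j] ordered[of j i] that by (cases "i \<le> j") (auto simp: norm_minus_commute)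
    then show ?thesis by blast
  qed
  from cauchy_L1_AE_cauchy_subseq[OF Z_int this] obtain r0 :: "nat \<Rightarrow> nat" where
    r0: "strict_mono r0" "AE y in ?M. Cauchy (\<lambda>i. Z (r0 i) y)" by blast
  have "(\<lambda>n. \<integral>y. norm ((defect (Z (r0 n)) y)\<^sup>2) \<partial>?M) \<longlonglongrightarrow> 0"
    using LIMSEQ_subseq_LIMSEQ[OF defect r0(1)] by (simp add: total_defect_def o_def)
  from tendsto_L1_AE_subseq[OF defect_integrable[OF Z] this] obtain r1 :: "nat \<Rightarrow> nat" where
    r1: "strict_mono r1" "AE y in ?M. (\<lambda>n. (defect (Z (r0 (r1 n))) y)\<^sup>2) \<longlonglongrightarrow> 0" by blast
  define \<zeta> where "\<zeta> y = lim (\<lambda>i. Z (r0 (r1 i)) y)" for y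
  have meas: "\<zeta> \<in> borel_measurable ?M"
    unfolding \<zeta>_def by (intro borel_measurable_lim_metric borel_measurable_integrable Z_int)
  have lim: "AE y in ?M. (\<lambda>i. Z (r0 (r1 i)) y) \<longlonglongrightarrow> \<zeta> y"
    using r0(2)
  proof eventually_elim
    case (elim y)
    then have "Cauchy (\<lambda>i. Z (r0 (r1 i)) y)"
      using Cauchy_subseq_Cauchy[OF elim r1(1)] by (simp add: o_def)
    then show ?case unfolding \<zeta>_def by (simp add: Cauchy_convergent_iff convergent_LIMSEQ_iff)
  qed
  have "AE y in ?M. y \<in> \<U>" by (rule AE_I2) simp
  with lim r1(2) have "AE y in ?M. \<zeta> y \<in> K y"
  proof eventually_elim
    case (elim y)
    have "(\<lambda>i. defect (Z (r0 (r1 i))) y) \<longlonglongrightarrow> infdist (\<zeta> y) (K y)"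
      unfolding defect_def by (intro tendsto_infdist elim(1))
    then have "(\<lambda>i. (defect (Z (r0 (r1 i))) y)\<^sup>2) \<longlonglongrightarrow> (infdist (\<zeta> y) (K y))\<^sup>2" by (rule tendsto_power)
    then have "(infdist (\<zeta> y) (K y))\<^sup>2 = 0" using elim(2) LIMSEQ_unique by blast
    then have "infdist (\<zeta> y) (K y) = 0" by simp
    moreover have "closed (K y)" "K y \<noteq> {}"
      using K_compact[OF elim(3)] by (auto simp: nonempty_compacts_def intro: compact_imp_closed)
    ultimately show ?case using in_closed_iff_infdist_zero by blast
  qed
  with meas lim show ?thesis by (intro exI[of _ "\<lambda>i. r0 (r1 i)"] exI[of _ \<zeta>] conjI)
qed

text \<open>The equation is stated for the difference to \<open>z0\<close>, which extends by zero to
  the whole space, whereas \<open>z0\<close> solves it only inside the larger domain.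
  \<open>has_bochner_integral\<close> is stronger than a vanishing integral, which could be a
  default value; the integrability is used when the pieces are glued.\<close>

lemma solution_near:
  assumes z: "z \<in> strict" and base: "z0 \<in> strict" "oscillation A \<U> (\<lambda>y. z y - z0 y)"
    and g: "continuous_on \<U> g" "bounded (g ` \<U>)" and \<epsilon>: "0 < \<epsilon>"
  shows "\<exists>\<zeta>. \<zeta> \<in> borel_measurable (lebesgue_on \<U>) \<and> (AE y in lebesgue_on \<U>. norm (\<zeta> y) \<le> R) \<and>
    (AE y in lebesgue_on \<U>. \<zeta> y \<in> K y) \<and>
    (\<forall>\<phi>\<in>test_functions UNIV. has_bochner_integral (lebesgue_on \<U>)
       (\<lambda>y. \<Sum>i\<in>UNIV. partial_deriv i \<phi> y *\<^sub>R (A i *v (\<zeta> y - z0 y))) 0) \<and>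
    \<bar>\<integral>y. (\<zeta> y - z y) \<bullet> g y \<partial>lebesgue_on \<U>\<bar> \<le> \<epsilon>"
proof -
  let ?M = "lebesgue_on \<U>"
  obtain Z where Z: "\<forall>k. Z k \<in> strict" and osc: "\<forall>k. oscillation A \<U> (\<lambda>y. Z k y - z y)"
    and close: "\<forall>k. \<bar>\<integral>y. (Z k y - z y) \<bullet> g y \<partial>?M\<bar> \<le> \<epsilon>"
    and defect: "(\<lambda>k. total_defect (Z k)) \<longlonglongrightarrow> 0"
    and cauchy: "\<forall>\<delta>>0. \<exists>n. \<forall>k\<ge>n. \<forall>m\<ge>k. (\<integral>y. (norm (Z m y - Z k y))\<^sup>2 \<partial>?M) < \<delta>"
    using iteration[OF z g \<epsilon>] by (elim exE conjE)
  obtain r \<zeta> where meas: "\<zeta> \<in> borel_measurable ?M"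
    and lim: "AE y in ?M. (\<lambda>i. Z (r i) y) \<longlonglongrightarrow> \<zeta> y" and inK: "AE y in ?M. \<zeta> y \<in> K y"
    using strict_subsequence_limit[of Z, OF spec[OF Z] cauchy defect] by (elim exE conjE)
  have inU: "AE y in ?M. y \<in> \<U>" by (rule AE_I2) simp
  have cont_meas: "h \<in> borel_measurable ?M" if "continuous_on \<U> h" for h :: "real^'d \<Rightarrow> 'z::euclidean_space"
    using that by (intro continuous_imp_measurable_on_sets_lebesgue U_sets)
  have diff_le: "norm (Z k y - u y) \<le> 2 * R" if "u \<in> strict" "y \<in> \<U>" for k u y
    using norm_triangle_ineq4[of "Z k y" "u y"] strict_norm_le[OF spec[OF Z, of k] that(2)] strict_norm_le[OF that]
    by simp
  have "AE y in ?M. norm (\<zeta> y) \<le> R"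
    using inK inU
  proof eventually_elim
    case (elim y)
    then show ?case using K_bounded[of y] by auto
  qed
  moreover have "has_bochner_integral ?M (\<lambda>y. \<Sum>i\<in>UNIV. partial_deriv i \<phi> y *\<^sub>R (A i *v (\<zeta> y - z0 y))) 0"
    if \<phi>: "\<phi> \<in> test_functions UNIV" for \<phi>
  proof -
    let ?F = "\<lambda>u y. \<Sum>i\<in>UNIV. partial_deriv i \<phi> y *\<^sub>R (A i *v (u y - z0 y))"
    \<comment> \<open>Two maps bounded by \<open>R\<close> differ by at most 2 R, and the operator
      norm of \<open>A i\<close> carries this bound through the matrix, uniformly in the
      iterate.\<close>
    define b where "b y = (\<Sum>i\<in>UNIV. norm (partial_deriv i \<phi> y) * (onorm ((*v) (A i)) * (2 * R)))" for y
    have pd_cont: "continuous_on S (partial_deriv i \<phi>)" for S i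
      using test_functionsD(2)[OF \<phi>] by (rule continuous_on_subset) simp
    have b_int: "integrable ?M b"
      unfolding b_def
      by (intro Bochner_Integration.integrable_sum integrable_mult_left integrable_norm
          integrable_continuous_bounded pd_cont bounded_image_continuous[OF pd_cont] bounded_U U_measurable)
    have Av: "(\<lambda>v. A i *v v) \<in> borel_measurable borel" for i
      by (intro borel_measurable_continuous_onI continuous_intros)
    have F_meas: "?F u \<in> borel_measurable ?M" if "u \<in> borel_measurable ?M" for u
      by (intro borel_measurable_sum borel_measurable_scaleR cont_meas[OF pd_cont] measurable_compose[OF _ Av]
          borel_measurable_diff that cont_meas strict_continuous base(1))
    have Z_meas: "Z (r k) \<in> borel_measurable ?M" for k
      by (intro cont_meas strict_continuous spec[OF Z])
    have F_lim: "AE y in ?M. (\<lambda>k. ?F (Z (r k)) y) \<longlonglongrightarrow> ?F \<zeta> y"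
      using lim
    proof eventually_elim
      case (elim y)
      then show ?case
        by (intro tendsto_intros bounded_linear.tendsto[OF matrix_vector_mul_bounded_linear])
    qed
    have F_le: "AE y in ?M. norm (?F (Z (r k)) y) \<le> b y" for k
      using inU
    proof eventually_elim
      case (elim y)
      have "norm (partial_deriv i \<phi> y *\<^sub>R (A i *v (Z (r k) y - z0 y)))
          \<le> norm (partial_deriv i \<phi> y) * (onorm ((*v) (A i)) * (2 * R))" for i
      proof -
        have "norm (A i *v (Z (r k) y - z0 y)) \<le> onorm ((*v) (A i)) * norm (Z (r k) y - z0 y)"
          by (rule onorm[OF matrix_vector_mul_bounded_linear])
        also have "\<dots> \<le> onorm ((*v) (A i)) * (2 * R)"
          using diff_le[OF base(1) elim] by (intro mult_left_mono onorm_pos_le matrix_vector_mul_bounded_linear)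
        finally show ?thesis by (simp add: mult_left_mono)
      qed
      then show ?case unfolding b_def by (intro order_trans[OF norm_sum] sum_mono)
    qed
    have F0: "(\<integral>y. ?F (Z k) y \<partial>?M) = 0" for k
    proof -
      have "oscillation A \<U> (\<lambda>y. Z k y - z0 y)"
        using oscillation_add[OF spec[OF osc] base(2) bounded_U] by simp
      then show ?thesis using \<phi>
        by (subst integral_restrict_support) (auto simp: oscillation_def)
    qed
    have "integrable ?M (?F \<zeta>)"
      by (rule integrable_dominated_convergence[where s = "\<lambda>k. ?F (Z (r k))", OF F_meas[OF meas] F_meas[OF Z_meas] b_int F_lim F_le])
    moreover have "(\<lambda>k. \<integral>y. ?F (Z (r k)) y \<partial>?M) \<longlonglongrightarrow> (\<integral>y. ?F \<zeta> y \<partial>?M)"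
      by (rule integral_dominated_convergence[where s = "\<lambda>k. ?F (Z (r k))", OF F_meas[OF meas] F_meas[OF Z_meas] b_int F_lim F_le])
    ultimately show ?thesis by (simp add: F0 LIMSEQ_const_iff has_bochner_integral_iff)
  qed
  moreover have "\<bar>\<integral>y. (\<zeta> y - z y) \<bullet> g y \<partial>?M\<bar> \<le> \<epsilon>"
  proof -
    have z_meas: "z \<in> borel_measurable ?M" "g \<in> borel_measurable ?M"
      by (intro cont_meas strict_continuous z g)+
    have "(\<lambda>k. \<integral>y. (Z (r k) y - z y) \<bullet> g y \<partial>?M) \<longlonglongrightarrow> (\<integral>y. (\<zeta> y - z y) \<bullet> g y \<partial>?M)"
    proof (rule integral_dominated_convergence[where w = "\<lambda>y. 2 * R * norm (g y)"])
      show "(\<lambda>y. (\<zeta> y - z y) \<bullet> g y) \<in> borel_measurable ?M"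
        by (intro borel_measurable_inner borel_measurable_diff meas z_meas)
      show "(\<lambda>y. (Z (r k) y - z y) \<bullet> g y) \<in> borel_measurable ?M" for k
        by (intro borel_measurable_inner borel_measurable_diff z_meas cont_meas strict_continuous spec[OF Z])
      show "integrable ?M (\<lambda>y. 2 * R * norm (g y))"
        by (intro integrable_mult_right integrable_norm integrable_continuous_bounded g U_measurable)
      show "AE y in ?M. (\<lambda>k. (Z (r k) y - z y) \<bullet> g y) \<longlonglongrightarrow> (\<zeta> y - z y) \<bullet> g y"
        using lim by eventually_elim (intro tendsto_intros)
      show "AE y in ?M. norm ((Z (r k) y - z y) \<bullet> g y) \<le> 2 * R * norm (g y)" for k
        using inU
      proof eventually_elim
        case (elim y)
        have "norm ((Z (r k) y - z y) \<bullet> g y) \<le> norm (Z (r k) y - z y) * norm (g y)"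
          using Cauchy_Schwarz_ineq2 by simp
        also have "\<dots> \<le> 2 * R * norm (g y)" using diff_le[OF z elim] by (rule mult_right_mono) simp
        finally show ?case .
      qed
    qed
    then have "(\<lambda>k. \<bar>\<integral>y. (Z (r k) y - z y) \<bullet> g y \<partial>?M\<bar>) \<longlonglongrightarrow> \<bar>\<integral>y. (\<zeta> y - z y) \<bullet> g y \<partial>?M\<bar>"
      by (rule tendsto_rabs)
    then show ?thesis by (rule LIMSEQ_le_const2) (use close in auto)
  qed
  ultimately show ?thesis using meas inK by blast
qed

text \<open>A wave with nonzero direction has positive energy by the wave cone bound, whatever the
  defect of \<open>z\<close> is. The perturbation step cannot supply it, since its energy bound is
  void where the total defect vanishes.\<close>

lemma nontrivial_oscillation:
  assumes z: "z \<in> strict" and "\<U> \<noteq> {}"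
  shows "\<exists>w. oscillation A \<U> w \<and> (\<forall>t\<in>{0..1}. (\<lambda>y. z y + t *\<^sub>R w y) \<in> strict) \<and>
    0 < (\<integral>y. (norm (w y))\<^sup>2 \<partial>lebesgue_on \<U>)"
proof -
  obtain a where a: "a \<in> \<U>" using assms(2) by blast
  let ?C = "convex hull (K a)"
  have "z a \<in> interior ?C" using z a by (simp add: strict_def)
  then obtain e where e: "e > 0" "ball (z a) e \<subseteq> interior ?C"
    using open_contains_ball open_interior by blast
  \<comment> \<open>A vector within distance less than e/2 of a vector of length e/2 is nonzero and
    shorter than e.\<close>
  obtain b :: "real^'n" where b: "norm b = e / 2" using e(1) by (metis vector_choose_size less_imp_le half_gt_zero)
  have "\<Lambda> \<inter> ball b (e / 2) \<noteq> {}"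
    using dense open_Int_closure_eq_empty[of "ball b (e / 2)" \<Lambda>] e(1) by auto
  then obtain zb where zb: "zb \<in> \<Lambda>" "dist b zb < e / 2" by auto
  have "zb \<noteq> 0" using zb(2) b by auto
  have "norm zb < e" using norm_triangle_ineq2[of zb b] zb(2) b by (simp add: dist_norm norm_minus_commute)
  then have "z a + zb \<in> interior ?C" "z a - zb \<in> interior ?C"
    using e(2) by (auto simp: dist_norm subset_iff)
  from segment_stable[OF z a this] obtain \<rho> r where r: "\<rho> > 0" "r > 0" "ball a r \<subseteq> \<U>"
    "\<And>y v. \<lbrakk>y \<in> ball a r; infdist v (closed_segment (- zb) zb) < \<rho>\<rbrakk> \<Longrightarrow> z y + v \<in> interior (convex hull (K y))"
    by blast
  obtain C w where w: "C > 0" "oscillation A (ball a r) w" "\<forall>x. infdist (w x) (closed_segment (- zb) zb) < \<rho>"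
    "C * r ^ CARD('d) * (norm zb)\<^sup>2 \<le> (\<integral>x. (norm (w x))\<^sup>2 \<partial>lebesgue)"
  proof -
    obtain C where "C > 0" and C: "\<forall>zb\<in>\<Lambda>. \<forall>a r \<rho> \<epsilon> G. 0 < r \<longrightarrow> 0 < \<rho> \<longrightarrow> 0 < \<epsilon> \<longrightarrow> finite G \<longrightarrow>
      (\<forall>g\<in>G. continuous_on (ball a r) g \<and> bounded (g ` ball a r)) \<longrightarrow>
      (\<exists>v. oscillation A (ball a r) v \<and> (\<forall>x. infdist (v x) (closed_segment (- zb) zb) < \<rho>) \<and>
          (\<forall>g\<in>G. \<bar>\<integral>x. v x \<bullet> g x \<partial>lebesgue\<bar> < \<epsilon>) \<and>
          C * r ^ CARD('d) * (norm zb)\<^sup>2 \<le> (\<integral>x. (norm (v x))\<^sup>2 \<partial>lebesgue))"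
      using wave_cone_localized[OF wave_cone] by (elim exE conjE)
    have "\<exists>v. oscillation A (ball a r) v \<and> (\<forall>x. infdist (v x) (closed_segment (- zb) zb) < \<rho>) \<and>
          (\<forall>g\<in>{}. \<bar>\<integral>x. v x \<bullet> g x \<partial>lebesgue\<bar> < 1) \<and>
          C * r ^ CARD('d) * (norm zb)\<^sup>2 \<le> (\<integral>x. (norm (v x))\<^sup>2 \<partial>lebesgue)"
      by (intro C[rule_format, OF zb(1) r(2) r(1)]) auto
    with \<open>C > 0\<close> that show thesis by blast
  qed
  have osc: "oscillation A \<U> w" using w(2) r(3) by (rule oscillation_mono)
  moreover have "(\<lambda>y. z y + t *\<^sub>R w y) \<in> strict" if t: "t \<in> {0..1}" for t
    unfolding strict_def
  proof (intro CollectI conjI ballI)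
    have "continuous_on \<U> w" using w(2) by (auto simp: oscillation_def intro: continuous_on_subset)
    then show "continuous_on \<U> (\<lambda>y. z y + t *\<^sub>R w y)"
      by (intro continuous_on_add strict_continuous[OF z] continuous_on_scaleR continuous_on_const)
    fix y assume y: "y \<in> \<U>"
    then have zy: "z y \<in> interior (convex hull (K y))" using z by (simp add: strict_def)
    show "z y + t *\<^sub>R w y \<in> interior (convex hull (K y))"
    proof (cases "y \<in> ball a r")
      case True
      then have "z y + w y \<in> interior (convex hull (K y))" using r(4) w(3) by blast
      \<comment> \<open>Both z y and z y + w y are interior, and the interior of a convex set is
        convex.\<close>
      then have "(1 - t) *\<^sub>R z y + t *\<^sub>R (z y + w y) \<in> interior (convex hull (K y))"
        using zy t by (intro convexD[OF convex_interior[OF convex_convex_hull]]) auto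
      then show ?thesis by (simp add: algebra_simps)
    next
      case False
      then have "w y = 0" using w(2) by (simp add: oscillation_def)
      then show ?thesis using zy by simp
    qed
  qed
  moreover have "0 < (\<integral>y. (norm (w y))\<^sup>2 \<partial>lebesgue_on \<U>)"
  proof -
    have "0 < C * r ^ CARD('d) * (norm zb)\<^sup>2" using w(1) r(2) \<open>zb \<noteq> 0\<close> by simp
    also have "\<dots> \<le> (\<integral>x. (norm (w x))\<^sup>2 \<partial>lebesgue)" by (rule w(4))
    also have "\<dots> = (\<integral>y. (norm (w y))\<^sup>2 \<partial>lebesgue_on \<U>)"
      using osc by (intro integral_restrict_support[symmetric] U_sets) (simp add: oscillation_def)
    finally show ?thesis .
  qed
  ultimately show ?thesis by blast
qed

text \<open>The glued map is \<open>z0\<close> plus the difference \<zeta> - z0 cut off to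
  \<open>\<U>\<close>, and each of the two terms satisfies the weak equation. Its squared norm is
  dominated by that of \<open>z0\<close> plus R^2 on the bounded set \<open>\<U>\<close>.\<close>

lemma glued_weak_solution:
  assumes D: "open \<D>" "\<U> \<subseteq> \<D>" and z0: "L2_weak_solution A \<D> z0"
    and meas: "\<zeta> \<in> borel_measurable (lebesgue_on \<U>)" and bd: "AE y in lebesgue_on \<U>. norm (\<zeta> y) \<le> R"
    and sol: "\<forall>\<phi>\<in>test_functions UNIV. has_bochner_integral (lebesgue_on \<U>)
       (\<lambda>y. \<Sum>i\<in>UNIV. partial_deriv i \<phi> y *\<^sub>R (A i *v (\<zeta> y - z0 y))) 0"
  shows "L2_weak_solution A \<D> (\<lambda>y. if y \<in> \<U> then \<zeta> y else z0 y)"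
proof -
  let ?z = "\<lambda>y. if y \<in> \<U> then \<zeta> y else z0 y"
  let ?N = "lebesgue_on \<D>"
  have D_sets: "\<D> \<in> sets lebesgue" using D(1) by (simp add: sets_completionI_sets)
  have U_N: "\<U> \<in> sets ?N" using D(2) D_sets by (simp add: sets_restrict_space_iff)
  have z0_L2: "z0 \<in> borel_measurable ?N" "integrable ?N (\<lambda>y. (norm (z0 y))\<^sup>2)"
    using z0 by (auto simp: L2_weak_solution_def L2_def)
  \<comment> \<open>\<zeta> is measurable only on \<open>\<U>\<close>, so it is first extended by
    zero to obtain a branch that is measurable on all of \<open>\<D>\<close>.\<close>
  have "(\<lambda>y. if y \<in> \<U> then \<zeta> y else 0) \<in> borel_measurable ?N"
    using meas borel_measurable_if_lebesgue_on[OF U_sets D_sets D(2)] by blast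
  then have "(\<lambda>y. if y \<in> \<U> then (if y \<in> \<U> then \<zeta> y else 0) else z0 y) \<in> borel_measurable ?N"
    by (rule measurable_If_set[OF _ z0_L2(1)]) (use U_N D(2) in \<open>simp add: Int_absorb2\<close>)
  then have z_meas: "?z \<in> borel_measurable ?N" by (simp cong: if_cong)
  have restrict: "lebesgue_on \<U> = restrict_space ?N \<U>"
    using D(2) by (simp add: restrict_restrict_space D_sets Int_absorb1)
  have "AE y in ?N. y \<in> \<U> \<longrightarrow> norm (\<zeta> y) \<le> R"
    using bd U_N D(2) unfolding restrict by (subst (asm) AE_restrict_space_iff) (auto simp: Int_absorb2)
  then have le: "AE y in ?N. norm ((norm (?z y))\<^sup>2) \<le> norm ((norm (z0 y))\<^sup>2 + R\<^sup>2 * indicator \<U> y)"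
    by eventually_elim (auto simp: power_mono add_increasing)
  have "emeasure ?N \<U> < \<infinity>"
    using U_measurable D(2) D_sets by (simp add: emeasure_restrict_space fmeasurable_def)
  then have "integrable ?N (\<lambda>y. (norm (z0 y))\<^sup>2 + R\<^sup>2 * indicator \<U> y)"
    using U_N by (intro Bochner_Integration.integrable_add z0_L2 integrable_mult_right integrable_real_indicator)
  from Bochner_Integration.integrable_bound[OF this _ le] have "integrable ?N (\<lambda>y. (norm (?z y))\<^sup>2)"
    using z_meas by (auto intro: borel_measurable_power borel_measurable_norm)
  with z_meas have "?z \<in> L2 \<D>" by (simp add: L2_def)
  moreover have "(\<integral>y. (\<Sum>i\<in>UNIV. partial_deriv i \<phi> y *\<^sub>R (A i *v ?z y)) \<partial>?N) = 0"
    if \<phi>: "\<phi> \<in> test_functions \<D>" for \<phi>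
  proof -
    let ?F = "\<lambda>u y. \<Sum>i\<in>UNIV. partial_deriv i \<phi> y *\<^sub>R (A i *v u y)"
    let ?d = "\<lambda>y. \<zeta> y - z0 y"
    have "has_bochner_integral (lebesgue_on \<U>) (?F ?d) 0"
      using sol test_functionsD(4)[OF \<phi>] by blast
    then have d: "integrable ?N (\<lambda>y. indicator \<U> y *\<^sub>R ?F ?d y)" "(\<integral>y. indicator \<U> y *\<^sub>R ?F ?d y \<partial>?N) = 0"
      using U_N D(2) unfolding restrict has_bochner_integral_iff
      by (simp_all add: integrable_restrict_space integral_restrict_space Int_absorb2)
    have split: "?F ?z y = ?F z0 y + indicator \<U> y *\<^sub>R ?F ?d y" for y
      by (simp add: matrix_vector_mult_diff_distrib scaleR_diff_right sum_subtractf)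
    have F0: "(\<integral>y. ?F z0 y \<partial>?N) = 0" using z0 \<phi> by (simp add: L2_weak_solution_def)
    show ?thesis
    proof (cases "integrable ?N (?F z0)")
      case True
      then show ?thesis unfolding split using d F0 by simp
    next
      case False \<comment> \<open>then both integrals have the junk value \<open>0\<close>\<close>
      have "\<not> integrable ?N (?F ?z)"
      proof
        assume "integrable ?N (?F ?z)"
        then have "integrable ?N (\<lambda>y. ?F ?z y - indicator \<U> y *\<^sub>R ?F ?d y)"
          using d(1) by (rule Bochner_Integration.integrable_diff)
        with False show False unfolding split by simp
      qed
      then show ?thesis by (rule not_integrable_integral_eq)
    qed
  qed
  ultimately show ?thesis by (simp add: L2_weak_solution_def)
qed

end

section \<open>Infinitely many classes from the values of one pairing\<close>

theorem theorem1:
  fixes \<D> \<U> :: "(real^'d::finite) set"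
    and A :: "'d \<Rightarrow> real^'n::finite^'m::finite"
    and K :: "real^'d \<Rightarrow> (real^'n) set"
    and \<Lambda> :: "(real^'n) set"
    and z\<^sub>0 :: "real^'d \<Rightarrow> real^'n"
  assumes "open \<D>"
    and "\<U> \<subseteq> \<D>" and "\<U> \<noteq> {}" and "bounded \<U>" and "open \<U>"
    and "\<forall>y\<in>\<D>. compact (K y)"
    and "wave_cone A \<Lambda>" and "closure \<Lambda> = UNIV"
    and "continuous_map (top_of_set \<U>) hausdorff.mtopology K"
    and "hausdorff.mbounded (K ` \<U>)"
    and "subsolution A \<D> \<U> K z\<^sub>0"
  shows "infinite ({z. L2_weak_solution A \<D> z \<and>
                       (AE y in lebesgue_on (\<D> - \<U>). z y = z\<^sub>0 y) \<and>
                       (AE y in lebesgue_on \<D>. z y \<in> K y)} // L2_eq \<D>)"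
proof -
  let ?S = "{z. L2_weak_solution A \<D> z \<and> (AE y in lebesgue_on (\<D> - \<U>). z y = z\<^sub>0 y) \<and>
                (AE y in lebesgue_on \<D>. z y \<in> K y)}"
  let ?M = "lebesgue_on \<U>"
  obtain R where R: "\<forall>y\<in>\<U>. K y \<in> nonempty_compacts \<and> K y \<subseteq> cball 0 R"
    using hausdorff_mboundedD[OF assms(10)] by blast
  interpret convex_integration A \<U> K \<Lambda> R
    using assms R hausdorff_continuousD[OF assms(9)] by unfold_locales blast+
  have z0: "z\<^sub>0 \<in> strict" "L2_weak_solution A \<D> z\<^sub>0" "AE y in lebesgue_on (\<D> - \<U>). z\<^sub>0 y \<in> K y"
    using assms(11) by (auto simp: subsolution_def strict_def)
  obtain w where w: "oscillation A \<U> w" "\<forall>t\<in>{0..1}. (\<lambda>y. z\<^sub>0 y + t *\<^sub>R w y) \<in> strict"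
      "0 < (\<integral>y. (norm (w y))\<^sup>2 \<partial>?M)"
    using nontrivial_oscillation[OF z0(1) assms(3)] by (elim exE conjE)
  define W where "W = (\<integral>y. (norm (w y))\<^sup>2 \<partial>?M)"
  have w_cont: "continuous_on UNIV w" using w(1) by (simp add: oscillation_def)
  have w_bd: "continuous_on \<U> w" "bounded (w ` \<U>)"
    using w_cont by (auto intro: continuous_on_subset bounded_image_continuous[OF _ bounded_U])
  have w_int: "integrable ?M (\<lambda>y. w y \<bullet> w y)"
    by (rule integrable_inner_continuous_bounded[OF w_bd w_bd U_measurable])
  \<comment> \<open>The functional that tells solutions apart: at z_0 + t w its value is t W, and W
    is positive.\<close>
  define V where "V z = (\<integral>y. (z y - z\<^sub>0 y) \<bullet> w y \<partial>?M)" for z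
  have D_sets: "\<D> \<in> sets lebesgue" using assms(1) by (simp add: sets_completionI_sets)
  \<comment> \<open>The solution built from the start z_0 + t w may lie far from it in norm, but its
    pairing with \<open>w\<close> differs from t W by at most the prescribed tolerance.\<close>
  have dense_values: "t * W \<in> closure (V ` ?S)" if t: "t \<in> {0..1}" for t
    unfolding closure_approachable
  proof (intro allI impI)
    fix e :: real assume e: "0 < e"
    let ?z = "\<lambda>y. z\<^sub>0 y + t *\<^sub>R w y"
    have z: "?z \<in> strict" using w(2) t by blast
    have osc: "oscillation A \<U> (\<lambda>y. ?z y - z\<^sub>0 y)" using oscillation_scaleR[OF w(1), of t] by simp
    obtain \<zeta> where \<zeta>: "\<zeta> \<in> borel_measurable ?M" "AE y in ?M. norm (\<zeta> y) \<le> R" "AE y in ?M. \<zeta> y \<in> K y"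
      "\<forall>\<phi>\<in>test_functions UNIV. has_bochner_integral ?M
         (\<lambda>y. \<Sum>i\<in>UNIV. partial_deriv i \<phi> y *\<^sub>R (A i *v (\<zeta> y - z\<^sub>0 y))) 0"
      "\<bar>\<integral>y. (\<zeta> y - ?z y) \<bullet> w y \<partial>?M\<bar> \<le> e / 2"
      using solution_near[OF z z0(1) osc w_bd half_gt_zero[OF e]] by (elim exE conjE)
    let ?\<zeta> = "\<lambda>y. if y \<in> \<U> then \<zeta> y else z\<^sub>0 y"
    have "L2_weak_solution A \<D> ?\<zeta>" by (rule glued_weak_solution[OF assms(1,2) z0(2) \<zeta>(1,2,4)])
    moreover have "AE y in lebesgue_on (\<D> - \<U>). ?\<zeta> y = z\<^sub>0 y" by (rule AE_I2) simp
    moreover have "AE y in lebesgue_on \<D>. ?\<zeta> y \<in> K y"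
    proof -
      have "AE y in lebesgue. y \<in> \<U> \<longrightarrow> \<zeta> y \<in> K y" using \<zeta>(3) by (simp add: AE_restrict_space_iff)
      moreover have "AE y in lebesgue. y \<in> \<D> - \<U> \<longrightarrow> z\<^sub>0 y \<in> K y"
        using z0(3) D_sets by (simp add: AE_restrict_space_iff)
      ultimately have "AE y in lebesgue. y \<in> \<D> \<longrightarrow> ?\<zeta> y \<in> K y" by eventually_elim auto
      then show ?thesis using D_sets by (simp add: AE_restrict_space_iff)
    qed
    ultimately have "?\<zeta> \<in> ?S" by blast
    moreover have "dist (V ?\<zeta>) (t * W) < e"
    proof -
      have "V ?\<zeta> = (\<integral>y. (\<zeta> y - z\<^sub>0 y) \<bullet> w y \<partial>?M)"
        unfolding V_def by (intro Bochner_Integration.integral_cong) auto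
      also have "\<dots> = (\<integral>y. (\<zeta> y - ?z y) \<bullet> w y + t * (w y \<bullet> w y) \<partial>?M)"
        by (intro Bochner_Integration.integral_cong) (auto simp: inner_simps)
      also have "\<dots> = (\<integral>y. (\<zeta> y - ?z y) \<bullet> w y \<partial>?M) + t * W"
      proof -
        have bound: "AE y in ?M. norm ((\<zeta> y - ?z y) \<bullet> w y) \<le> norm (2 * R * norm (w y))"
        proof -
          have "AE y in ?M. y \<in> \<U>" by (rule AE_I2) simp
          with \<zeta>(2) show ?thesis
          proof eventually_elim
            case (elim y)
            have "norm (\<zeta> y - ?z y) \<le> 2 * R"
              using norm_triangle_ineq4[of "\<zeta> y" "?z y"] elim(1) strict_norm_le[OF z elim(2)] by simp
            then have "norm (\<zeta> y - ?z y) * norm (w y) \<le> 2 * R * norm (w y)" by (rule mult_right_mono) simp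
            then show ?case
              using Cauchy_Schwarz_ineq2[of "\<zeta> y - ?z y" "w y"] abs_ge_self[of "2 * R * norm (w y)"]
              by (simp only: real_norm_def)
          qed
        qed
        have "integrable ?M (\<lambda>y. 2 * R * norm (w y))"
          by (intro integrable_mult_right integrable_norm integrable_continuous_bounded w_bd U_measurable)
        then have "integrable ?M (\<lambda>y. (\<zeta> y - ?z y) \<bullet> w y)"
        proof (rule Bochner_Integration.integrable_bound[OF _ _ bound])
          show "(\<lambda>y. (\<zeta> y - ?z y) \<bullet> w y) \<in> borel_measurable ?M"
            by (intro borel_measurable_inner borel_measurable_diff \<zeta>(1)
                continuous_imp_measurable_on_sets_lebesgue w_bd strict_continuous[OF z] U_sets)
        qed
        moreover have "integrable ?M (\<lambda>y. t * (w y \<bullet> w y))" using w_int by (rule integrable_mult_right)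
        ultimately show ?thesis
          using Bochner_Integration.integral_add[of ?M "\<lambda>y. (\<zeta> y - ?z y) \<bullet> w y" "\<lambda>y. t * (w y \<bullet> w y)"]
          by (simp add: W_def power2_norm_eq_inner)
      qed
      finally show ?thesis using \<zeta>(5) e by (simp add: dist_real_def)
    qed
    ultimately show "\<exists>v\<in>V ` ?S. dist v (t * W) < e" by blast
  qed
  show ?thesis
  proof
    assume fin: "finite (?S // L2_eq \<D>)"
    \<comment> \<open>Since \<open>V\<close> is constant on classes, finitely many classes could
      produce only finitely many values.\<close>
    have V_cong: "V x = V y" if "(x, y) \<in> L2_eq \<D>" for x y
    proof -
      have xy: "x \<in> borel_measurable (lebesgue_on \<D>)" "y \<in> borel_measurable (lebesgue_on \<D>)"
          "AE u in lebesgue_on \<D>. x u = y u"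
        using that by (auto simp: L2_eq_def L2_def)
      have restrict: "?M = restrict_space (lebesgue_on \<D>) \<U>"
        using assms(2) D_sets by (simp add: restrict_restrict_space Int_absorb1)
      have "AE u in lebesgue. u \<in> \<D> \<longrightarrow> x u = y u" using xy(3) D_sets by (simp add: AE_restrict_space_iff)
      then have "AE u in lebesgue. u \<in> \<U> \<longrightarrow> x u = y u" by eventually_elim (use assms(2) in blast)
      then have "AE u in ?M. x u = y u" by (simp add: AE_restrict_space_iff)
      then have ae: "AE u in ?M. (x u - z\<^sub>0 u) \<bullet> w u = (y u - z\<^sub>0 u) \<bullet> w u" by eventually_elim simp
      have "x \<in> borel_measurable ?M" "y \<in> borel_measurable ?M"
        unfolding restrict by (intro measurable_restrict_space1 xy)+
      moreover have "z\<^sub>0 \<in> borel_measurable ?M" "w \<in> borel_measurable ?M"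
        by (intro continuous_imp_measurable_on_sets_lebesgue w_bd strict_continuous z0(1) U_sets)+
      ultimately show ?thesis unfolding V_def
        by (intro integral_cong_AE ae borel_measurable_inner borel_measurable_diff)
    qed
    have "V ` ?S \<subseteq> (\<lambda>c. V (SOME y. y \<in> c)) ` (?S // L2_eq \<D>)"
    proof
      fix v assume "v \<in> V ` ?S"
      then obtain x where x: "x \<in> ?S" "v = V x" by blast
      then have "x \<in> L2 \<D>" by (simp add: L2_weak_solution_def)
      then have "x \<in> L2_eq \<D> `` {x}" by (rule equiv_class_self[OF equiv_L2_eq])
      then have "(SOME y. y \<in> L2_eq \<D> `` {x}) \<in> L2_eq \<D> `` {x}"
        by (rule someI[of "\<lambda>y. y \<in> L2_eq \<D> `` {x}"])
      then have "v = V (SOME y. y \<in> L2_eq \<D> `` {x})" using V_cong x(2) by blast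
      moreover have "L2_eq \<D> `` {x} \<in> ?S // L2_eq \<D>" using x(1) by (rule quotientI)
      ultimately show "v \<in> (\<lambda>c. V (SOME y. y \<in> c)) ` (?S // L2_eq \<D>)" by blast
    qed
    then have "finite (V ` ?S)" using fin by (meson finite_imageI finite_subset)
    \<comment> \<open>A finite set of values is closed, so it would have to contain every t W with t
      in [0,1].\<close>
    then have "closure (V ` ?S) = V ` ?S" by (intro closure_closed finite_imp_closed)
    then have "(\<lambda>t. t * W) ` {0..1} \<subseteq> V ` ?S" using dense_values by blast
    then have "finite ((\<lambda>t. t * W) ` {0..1})" using \<open>finite (V ` ?S)\<close> by (rule finite_subset)
    moreover have "inj_on (\<lambda>t. t * W) {0..1}" using w(3) by (auto simp: inj_on_def W_def)
    ultimately have "finite {0..1::real}" by (rule finite_imageD)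
    then show False using infinite_Icc[of "0::real" 1] by simp
  qed
qed

end
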